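(* Assume $\alpha_1\alpha_2<1/4$. The Wiener integral $$Z_t=\int_0^t(t/s)^A\,dB_s$$ is well-defined for every $t>0$. Furthermore, the covariance matrix of $\{Z_t\}_{t\ge0}$ is given by $$\mathbb{E}[Z_sZ_t^\top]=s\,\Sigma\,(t/s)^{A^\top},\qquad 0<s\le t,$$ where $$\Sigma:=\mathbb{E}[Z_1Z_1^\top]=\frac1{1-4\alpha_1\alpha_2}\begin{pmatrix}1+2\alpha_1^2-2\alpha_1\alpha_2&\alpha_1+\alpha_2\\ \alpha_1+\alpha_2&1+2\alpha_2^2-2\alpha_1\alpha_2\end{pmatrix}.$$
   Context: $\alpha_1,\alpha_2\in[-1,1]$, $A=\begin{pmatrix}0&\alpha_1\\ \alpha_2&0\end{pmatrix}$, $x^A:=e^{(\log x)A}$ (and $x^{A^\top}:=e^{(\log x)A^\top}$) for $x>0$, and $\{B_t\}_{t\ge0}$ is a two-dimensional standard Brownian motion. "Well-defined" means that the deterministic matrix integrand $s\mapsto(t/s)^A$ is square integrable on $(0,t)$. *)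

theory Defs
  imports "HOL-Probability.Probability"
begin

text \<open>
  The class-based \<open>exp\<close> and \<open>(^)\<close> cannot be used for matrices: multiplication on \<open>vec\<close> is
  componentwise, matrix multiplication being \<open>(**)\<close>.
\<close>

definition matrix_exp :: "real^'n^'n \<Rightarrow> real^'n^'n" where
  "matrix_exp X = (\<Sum>k. (1 / fact k) *\<^sub>R (((**) X ^^ k) (mat 1)))"

definition rpow_matrix :: "real \<Rightarrow> real^'n^'n \<Rightarrow> real^'n^'n" where
  "rpow_matrix x A = matrix_exp (ln x *\<^sub>R A)"

definition outer_prod :: "real^'n \<Rightarrow> real^'m \<Rightarrow> real^'m^'n" where
  "outer_prod x y = (columnvector x :: real^1^'n) ** (rowvector y :: real^'m^1)"

text \<open>
  The density of an increment is that of the centred Gaussian law with covariance matrix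
  \<open>(t - s)\<close> times the identity, so the components are independent one-dimensional standard
  Brownian motions. The process is only constrained at nonnegative times. Testing independence of
  increments on infinite strictly increasing sequences loses nothing, since every finite
  partition extends to such a sequence.
\<close>

locale standard_brownian_motion = prob_space M
  for M :: "'a measure" and B :: "real \<Rightarrow> 'a \<Rightarrow> real^'n" +
  assumes random_variable_B: "\<And>t. 0 \<le> t \<Longrightarrow> random_variable borel (B t)"
    and B_0: "AE \<omega> in M. B 0 \<omega> = 0"
    and independent_increments:
      "\<And>\<tau> n. strict_mono \<tau> \<Longrightarrow> 0 \<le> \<tau> 0 \<Longrightarrow>
        indep_vars (\<lambda>_. borel) (\<lambda>i \<omega>. B (\<tau> (Suc i)) \<omega> - B (\<tau> i) \<omega>) {..<n::nat}"
    and gaussian_increments: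
      "\<And>s t. 0 \<le> s \<Longrightarrow> s < t \<Longrightarrow>
        distributed M lborel (\<lambda>\<omega>. B t \<omega> - B s \<omega>)
          (\<lambda>x. ennreal (\<Prod>i\<in>UNIV. normal_density 0 (sqrt (t - s)) (x $ i)))"
    and continuous_paths: "AE \<omega> in M. continuous_on {0..} (\<lambda>t. B t \<omega>)"

text \<open>
  Square integrability of a deterministic matrix-valued integrand; the norm on \<open>real^'n^'m\<close> is the
  Frobenius norm.
\<close>

definition square_integrable_on :: "(real \<Rightarrow> real^'n^'m) \<Rightarrow> real set \<Rightarrow> bool" where
  "square_integrable_on F S \<longleftrightarrow>
     set_borel_measurable lborel S F \<and> set_integrable lborel S (\<lambda>s. (norm (F s))\<^sup>2)"

text \<open>
  Step integrands, taking the value \<open>C i\<close> on the interval from \<open>\<tau> i\<close> to \<open>\<tau> (Suc i)\<close>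
  for \<open>i < n\<close>, and their elementary integral against \<open>B\<close>.
\<close>

definition step_integrand :: "(nat \<Rightarrow> real) \<Rightarrow> (nat \<Rightarrow> real^'n^'m) \<Rightarrow> nat \<Rightarrow> real \<Rightarrow> real^'n^'m" where
  "step_integrand \<tau> C n s = (\<Sum>i<n. indicator {\<tau> i<..\<tau> (Suc i)} s *\<^sub>R C i)"

definition step_integral ::
    "(real \<Rightarrow> 'a \<Rightarrow> real^'n) \<Rightarrow> (nat \<Rightarrow> real) \<Rightarrow> (nat \<Rightarrow> real^'n^'m) \<Rightarrow> nat \<Rightarrow> 'a \<Rightarrow> real^'m" where
  "step_integral B \<tau> C n \<omega> = (\<Sum>i<n. C i *v (B (\<tau> (Suc i)) \<omega> - B (\<tau> i) \<omega>))"

text \<open>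
  The Wiener integral of \<open>F\<close> over \<open>(a,b)\<close> is the limit, in mean square, of the elementary integrals
  of step integrands converging to \<open>F\<close> in \<open>L\<^sup>2(a,b)\<close>. It is determined up to almost sure equality;
  \<open>wiener_integral\<close> selects one version.
\<close>

definition has_wiener_integral ::
    "'a measure \<Rightarrow> (real \<Rightarrow> 'a \<Rightarrow> real^'n) \<Rightarrow> real \<Rightarrow> real \<Rightarrow> (real \<Rightarrow> real^'n^'m) \<Rightarrow> ('a \<Rightarrow> real^'m) \<Rightarrow> bool" where
  "has_wiener_integral M B a b F I \<longleftrightarrow>
     square_integrable_on F {a<..<b} \<and> I \<in> borel_measurable M \<and>
     (\<exists>\<tau> C n.
        (\<forall>k. mono (\<tau> k) \<and> range (\<tau> k) \<subseteq> {a..b}) \<and>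
        (\<lambda>k. \<integral>\<^sup>+ s \<in> {a<..<b}. ennreal ((norm (F s - step_integrand (\<tau> k) (C k) (n k) s))\<^sup>2) \<partial>lborel)
          \<longlonglongrightarrow> 0 \<and>
        (\<lambda>k. \<integral>\<^sup>+ \<omega>. ennreal ((norm (I \<omega> - step_integral B (\<tau> k) (C k) (n k) \<omega>))\<^sup>2) \<partial>M)
          \<longlonglongrightarrow> 0)"

definition wiener_integral ::
    "'a measure \<Rightarrow> (real \<Rightarrow> 'a \<Rightarrow> real^'n) \<Rightarrow> real \<Rightarrow> real \<Rightarrow> (real \<Rightarrow> real^'n^'m) \<Rightarrow> 'a \<Rightarrow> real^'m" where
  "wiener_integral M B a b F = (SOME I. has_wiener_integral M B a b F I)"

end

theory Submission
  imports Defs "HOL-Real_Asymp.Real_Asymp"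
begin

text \<open>
  Write \<open>F t u\<close> for \<open>rpow_matrix (t / u) A\<close>. The proof combines two independent parts.

  The probabilistic part is the Ito isometry: Wiener integrals of \<open>F\<close> over \<open>(a,b)\<close> and of \<open>G\<close> over
  \<open>(c,d)\<close> have as covariance matrix the Lebesgue integral of \<open>F ** transpose G\<close> over the
  intersection of the two intervals (\<open>wiener_integral_covariance\<close>). For step integrands this is the
  covariance structure of Brownian increments, and it passes to mean-square limits. The isometry also
  shows that a continuous square integrable integrand possesses a Wiener integral
  (\<open>has_wiener_integral_exists\<close>), so that \<open>wiener_integral\<close>, which selects some version, indeed
  selects a Wiener integral. Everything about the covariances of \<open>Z\<close> is thereby reduced to the
  integrals of \<open>F s u ** transpose (F t u)\<close> over \<open>0 < u < s\<close>.

  The analytic part evaluates these integrals without computing the entries of \<open>F\<close>. Let \<open>S\<close> solve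
  the Lyapunov equation \<open>S = mat 1 + A ** S + S ** transpose A\<close>. As the derivative of \<open>F t u\<close> in \<open>u\<close>
  is \<open>A ** F t u\<close> divided by \<open>- u\<close>, and \<open>A\<close> commutes with \<open>F s u\<close>, the matrix
  \<open>u *\<^sub>R (F s u ** S ** transpose (F t u))\<close> is a primitive of \<open>F s u ** transpose (F t u)\<close>. At \<open>u = s\<close>
  it equals \<open>s *\<^sub>R (S ** transpose (F t s))\<close>, which is the asserted covariance. At \<open>0\<close> it vanishes:
  here \<open>A ** A\<close> is \<open>c = \<alpha>\<^sub>1 * \<alpha>\<^sub>2\<close> times the identity, so \<open>F t u\<close> grows at most like \<open>u\<close> to the power
  \<open>- Re (csqrt c)\<close> as \<open>u\<close> tends to \<open>0\<close>, up to a logarithm, and \<open>Re (csqrt c) < 1/2\<close> because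
  \<open>c < 1/4\<close>. The same primitive with \<open>s = t\<close>, after taking traces, gives square integrability.
  Finally, the matrix \<open>\<Sigma>\<close> of the theorem is the solution of the Lyapunov equation
  (\<open>antidiagonal_lyapunov\<close>), and \<open>s = t = 1\<close> identifies it as the covariance matrix of \<open>Z 1\<close>.
\<close>

section \<open>Bilinear maps and mean-square convergence\<close>

text \<open>
  The integrands and the random variables below are vectors or matrices, and the products of
  interest are \<open>outer_prod x y\<close> and \<open>X ** transpose Y\<close>. Stating the mean-square calculus for an
  arbitrary bounded bilinear map covers both.
\<close>

lemma bilinear_integrable:
  fixes f :: "'a \<Rightarrow> 'b::euclidean_space" and g :: "'a \<Rightarrow> 'c::euclidean_space"
    and h :: "'b \<Rightarrow> 'c \<Rightarrow> 'd::euclidean_space"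
  assumes h: "bounded_bilinear h"
    and [measurable]: "f \<in> borel_measurable N" "g \<in> borel_measurable N"
    and f: "integrable N (\<lambda>x. (norm (f x))\<^sup>2)" and g: "integrable N (\<lambda>x. (norm (g x))\<^sup>2)"
  shows "integrable N (\<lambda>x. h (f x) (g x))"
proof -
  obtain K where K: "K > 0" "\<And>a b. norm (h a b) \<le> norm a * norm b * K"
    using bounded_bilinear.pos_bounded[OF h] by blast
  show ?thesis
  proof (rule Bochner_Integration.integrable_bound)
    show "integrable N (\<lambda>x. K * ((norm (f x))\<^sup>2 + (norm (g x))\<^sup>2))"
      using f g by auto
    show "(\<lambda>x. h (f x) (g x)) \<in> borel_measurable N"
    proof (rule borel_measurable_continuous_Pair[where H = h and f = f and g = g])
      have "continuous_on UNIV (fst :: 'b \<times> 'c \<Rightarrow> 'b)" "continuous_on UNIV (snd :: 'b \<times> 'c \<Rightarrow> 'c)"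
        by (intro continuous_intros)+
      then show "continuous_on UNIV (\<lambda>x. h (fst x) (snd x))"
        by (rule bounded_bilinear.continuous_on[OF h])
    qed (use assms in auto)
    show "AE x in N. norm (h (f x) (g x)) \<le> norm (K * ((norm (f x))\<^sup>2 + (norm (g x))\<^sup>2))"
    proof (rule AE_I2)
      fix x
      have "2 * (norm (f x) * norm (g x)) \<le> (norm (f x))\<^sup>2 + (norm (g x))\<^sup>2"
        using sum_squares_bound[of "norm (f x)" "norm (g x)"] by simp
      moreover have "0 \<le> norm (f x) * norm (g x)" by simp
      ultimately have "norm (f x) * norm (g x) \<le> (norm (f x))\<^sup>2 + (norm (g x))\<^sup>2"
        by linarith
      then have "norm (f x) * norm (g x) * K \<le> K * ((norm (f x))\<^sup>2 + (norm (g x))\<^sup>2)"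
        using K(1) by (simp add: mult.commute)
      then show "norm (h (f x) (g x)) \<le> norm (K * ((norm (f x))\<^sup>2 + (norm (g x))\<^sup>2))"
        using K(2)[of "f x" "g x"] by simp
    qed
  qed
qed

lemma integral_norm_mult_le:
  fixes f :: "'a \<Rightarrow> 'b::euclidean_space" and g :: "'a \<Rightarrow> 'c::euclidean_space"
  assumes [measurable]: "f \<in> borel_measurable N" "g \<in> borel_measurable N"
    and f: "integrable N (\<lambda>x. (norm (f x))\<^sup>2)" and g: "integrable N (\<lambda>x. (norm (g x))\<^sup>2)"
  shows "integrable N (\<lambda>x. norm (f x) * norm (g x))"
    and "(LINT x|N. norm (f x) * norm (g x))
      \<le> sqrt (LINT x|N. (norm (f x))\<^sup>2) * sqrt (LINT x|N. (norm (g x))\<^sup>2)"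
proof -
  show i: "integrable N (\<lambda>x. norm (f x) * norm (g x))"
    using bilinear_integrable[OF bounded_bilinear_mult, of "\<lambda>x. norm (f x)" N "\<lambda>x. norm (g x)"] f g
    by simp
  have "(\<integral>\<^sup>+x. ennreal (norm (f x)) * ennreal (norm (g x)) \<partial>N)\<^sup>2
      \<le> (\<integral>\<^sup>+x. (ennreal (norm (f x)))\<^sup>2 \<partial>N) * (\<integral>\<^sup>+x. (ennreal (norm (g x)))\<^sup>2 \<partial>N)"
    by (rule Cauchy_Schwarz_nn_integral) auto
  then have "ennreal ((LINT x|N. norm (f x) * norm (g x))\<^sup>2)
      \<le> ennreal ((LINT x|N. (norm (f x))\<^sup>2) * (LINT x|N. (norm (g x))\<^sup>2))"
    by (simp add: nn_integral_eq_integral i f g ennreal_power flip: ennreal_mult)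
  then have "(LINT x|N. norm (f x) * norm (g x))\<^sup>2
      \<le> (LINT x|N. (norm (f x))\<^sup>2) * (LINT x|N. (norm (g x))\<^sup>2)"
    by (subst (asm) ennreal_le_iff) (auto intro!: mult_nonneg_nonneg integral_nonneg_AE)
  then show "(LINT x|N. norm (f x) * norm (g x))
      \<le> sqrt (LINT x|N. (norm (f x))\<^sup>2) * sqrt (LINT x|N. (norm (g x))\<^sup>2)"
    unfolding real_sqrt_mult[symmetric] by (rule real_le_rsqrt)
qed

lemma mean_square_integrable_minus:
  fixes f g :: "'a \<Rightarrow> 'b::euclidean_space"
  assumes [measurable]: "f \<in> borel_measurable N" "g \<in> borel_measurable N"
    and f: "integrable N (\<lambda>x. (norm (f x))\<^sup>2)" and g: "integrable N (\<lambda>x. (norm (g x))\<^sup>2)"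
  shows "integrable N (\<lambda>x. (norm (f x - g x))\<^sup>2)"
proof (rule Bochner_Integration.integrable_bound)
  show "integrable N (\<lambda>x. 2 * (norm (f x))\<^sup>2 + 2 * (norm (g x))\<^sup>2)" using f g by simp
  show "AE x in N. norm ((norm (f x - g x))\<^sup>2) \<le> norm (2 * (norm (f x))\<^sup>2 + 2 * (norm (g x))\<^sup>2)"
  proof (rule AE_I2)
    fix x
    have "(norm (f x - g x))\<^sup>2 \<le> (norm (f x) + norm (g x))\<^sup>2"
      by (intro power_mono norm_triangle_ineq4) auto
    also have "\<dots> \<le> 2 * (norm (f x))\<^sup>2 + 2 * (norm (g x))\<^sup>2"
      using sum_squares_bound[of "norm (f x)" "norm (g x)"] by (simp add: power2_sum)
    finally show "norm ((norm (f x - g x))\<^sup>2) \<le> norm (2 * (norm (f x))\<^sup>2 + 2 * (norm (g x))\<^sup>2)"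
      by simp
  qed
qed auto

text \<open>
  This carries the isometry from step integrands to their limits: writing \<open>f'\<close> and \<open>g'\<close> as
  perturbations of \<open>f\<close> and \<open>g\<close> and expanding \<open>h\<close>, each of the three error terms is bounded by a
  product of mean-square norms, one of which tends to zero.
\<close>

lemma bilinear_integral_tendsto:
  fixes f :: "'a \<Rightarrow> 'b::euclidean_space" and g :: "'a \<Rightarrow> 'c::euclidean_space"
    and h :: "'b \<Rightarrow> 'c \<Rightarrow> 'd::euclidean_space"
  assumes h: "bounded_bilinear h"
    and [measurable]: "f \<in> borel_measurable N" "g \<in> borel_measurable N"
      "\<And>k. f' k \<in> borel_measurable N" "\<And>k. g' k \<in> borel_measurable N"
    and f: "integrable N (\<lambda>x. (norm (f x))\<^sup>2)" and g: "integrable N (\<lambda>x. (norm (g x))\<^sup>2)"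
    and f': "\<And>k. integrable N (\<lambda>x. (norm (f' k x))\<^sup>2)"
    and g': "\<And>k. integrable N (\<lambda>x. (norm (g' k x))\<^sup>2)"
    and lf: "(\<lambda>k. LINT x|N. (norm (f x - f' k x))\<^sup>2) \<longlonglongrightarrow> 0"
    and lg: "(\<lambda>k. LINT x|N. (norm (g x - g' k x))\<^sup>2) \<longlonglongrightarrow> 0"
  shows "(\<lambda>k. LINT x|N. h (f' k x) (g' k x)) \<longlonglongrightarrow> (LINT x|N. h (f x) (g x))"
proof -
  interpret h: bounded_bilinear h by fact
  obtain K where K: "K > 0" "\<And>a b. norm (h a b) \<le> norm a * norm b * K"
    using h.pos_bounded by blast
  note df = mean_square_integrable_minus[OF _ _ f f']
  note dg = mean_square_integrable_minus[OF _ _ g g']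
  define a where "a k = sqrt (LINT x|N. (norm (f x - f' k x))\<^sup>2)" for k
  define b where "b k = sqrt (LINT x|N. (norm (g x - g' k x))\<^sup>2)" for k
  define F where "F = sqrt (LINT x|N. (norm (f x))\<^sup>2)"
  define G where "G = sqrt (LINT x|N. (norm (g x))\<^sup>2)"
  have a0: "a \<longlonglongrightarrow> 0" and b0: "b \<longlonglongrightarrow> 0"
    unfolding a_def b_def using tendsto_real_sqrt[OF lf] tendsto_real_sqrt[OF lg] by auto
  have bound: "norm ((LINT x|N. h (f' k x) (g' k x)) - (LINT x|N. h (f x) (g x)))
      \<le> K * (a k * G + F * b k + a k * b k)" for k
  proof -
    have i1: "integrable N (\<lambda>x. h (f' k x) (g' k x))" "integrable N (\<lambda>x. h (f x) (g x))"
      using f f' g g' by (auto intro!: bilinear_integrable[OF h])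
    have n: "norm (h (f' k x) (g' k x) - h (f x) (g x))
        \<le> K * (norm (f x - f' k x) * norm (g x) + norm (f x) * norm (g x - g' k x)
           + norm (f x - f' k x) * norm (g x - g' k x))" for x
    proof -
      have eq: "h (f' k x) (g' k x) - h (f x) (g x)
          = h (f x - f' k x) (g x - g' k x) - h (f x - f' k x) (g x) - h (f x) (g x - g' k x)"
        by (simp add: h.diff_left h.diff_right)
      have "norm (h (f' k x) (g' k x) - h (f x) (g x))
          \<le> norm (h (f x - f' k x) (g x - g' k x)) + norm (h (f x - f' k x) (g x))
            + norm (h (f x) (g x - g' k x))"
        unfolding eq by (smt (verit) norm_triangle_ineq4)
      also have "\<dots> \<le> norm (f x - f' k x) * norm (g x - g' k x) * K
            + norm (f x - f' k x) * norm (g x) * K + norm (f x) * norm (g x - g' k x) * K"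
        by (intro add_mono K(2))
      finally show ?thesis by (simp add: algebra_simps)
    qed
    note ia = integral_norm_mult_le[of "\<lambda>x. f x - f' k x" N g]
      and ib = integral_norm_mult_le[of f N "\<lambda>x. g x - g' k x"]
      and ic = integral_norm_mult_le[of "\<lambda>x. f x - f' k x" N "\<lambda>x. g x - g' k x"]
    have "norm ((LINT x|N. h (f' k x) (g' k x)) - (LINT x|N. h (f x) (g x)))
        = norm (LINT x|N. h (f' k x) (g' k x) - h (f x) (g x))"
      using i1 by simp
    also have "\<dots> \<le> (LINT x|N. norm (h (f' k x) (g' k x) - h (f x) (g x)))"
      by (rule integral_norm_bound)
    also have "\<dots> \<le> (LINT x|N. K * (norm (f x - f' k x) * norm (g x)
          + norm (f x) * norm (g x - g' k x) + norm (f x - f' k x) * norm (g x - g' k x)))"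
      using i1 ia(1) ib(1) ic(1) f g df dg n
      by (intro integral_mono integrable_norm Bochner_Integration.integrable_diff
          integrable_mult_right Bochner_Integration.integrable_add) auto
    also have "\<dots> = K * ((LINT x|N. norm (f x - f' k x) * norm (g x))
          + (LINT x|N. norm (f x) * norm (g x - g' k x))
          + (LINT x|N. norm (f x - f' k x) * norm (g x - g' k x)))"
      using ia(1) ib(1) ic(1) f g df dg by simp
    also have "\<dots> \<le> K * (a k * G + F * b k + a k * b k)"
      unfolding a_def b_def F_def G_def using K(1) ia(2) ib(2) ic(2) f g df dg
      by (intro mult_left_mono add_mono) auto
    finally show ?thesis .
  qed
  have "(\<lambda>k. K * (a k * G + F * b k + a k * b k)) \<longlonglongrightarrow> K * (0 * G + F * 0 + 0 * 0)"
    by (intro tendsto_intros a0 b0)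
  then have "(\<lambda>k. K * (a k * G + F * b k + a k * b k)) \<longlonglongrightarrow> 0" by simp
  then have "(\<lambda>k. (LINT x|N. h (f' k x) (g' k x)) - (LINT x|N. h (f x) (g x))) \<longlonglongrightarrow> 0"
    by (rule Lim_null_comparison[OF always_eventually, rotated]) (use bound in auto)
  then show ?thesis by (simp add: LIM_zero_iff)
qed

text \<open>
  Completeness of the space of square integrable vector-valued functions, for a sequence that is
  Cauchy at a geometric rate. The rate makes
  \<open>\<Sum>k. 2 ^ k * (norm (X (Suc k) - X k))\<^sup>2\<close> integrable, hence almost everywhere finite; so \<open>X\<close>
  converges almost everywhere, and Fatou's lemma upgrades this to convergence in mean square.
\<close>

lemma mean_square_limit_exists:
  fixes X :: "nat \<Rightarrow> 'a \<Rightarrow> 'b::euclidean_space"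
  assumes [measurable]: "\<And>k. X k \<in> borel_measurable N"
    and fin: "finite_measure N"
    and bnd: "\<And>j k. k \<le> j \<Longrightarrow> (\<integral>\<^sup>+x. ennreal ((norm (X j x - X k x))\<^sup>2) \<partial>N) \<le> ennreal (c / 4 ^ k)"
    and c: "0 \<le> c"
  obtains Y where "Y \<in> borel_measurable N"
    "(\<lambda>k. \<integral>\<^sup>+x. ennreal ((norm (Y x - X k x))\<^sup>2) \<partial>N) \<longlonglongrightarrow> 0"
proof -
  interpret finite_measure N by fact
  define D where "D k x = X (Suc k) x - X k x" for k x
  have [measurable]: "D k \<in> borel_measurable N" for k unfolding D_def by measurable
  have "(\<integral>\<^sup>+x. (\<Sum>k. ennreal (2 ^ k * (norm (D k x))\<^sup>2)) \<partial>N)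
      = (\<Sum>k. \<integral>\<^sup>+x. ennreal (2 ^ k * (norm (D k x))\<^sup>2) \<partial>N)"
    by (rule nn_integral_suminf) auto
  also have "\<dots> \<le> (\<Sum>k. ennreal (c * (1/2) ^ k))"
  proof (rule suminf_le)
    fix k
    have "(\<integral>\<^sup>+x. ennreal (2 ^ k * (norm (D k x))\<^sup>2) \<partial>N)
       = ennreal (2 ^ k) * (\<integral>\<^sup>+x. ennreal ((norm (D k x))\<^sup>2) \<partial>N)"
      by (simp add: ennreal_mult nn_integral_cmult)
    also have "\<dots> \<le> ennreal (2 ^ k) * ennreal (c / 4 ^ k)"
      using bnd[of k "Suc k"] by (intro mult_left_mono) (auto simp: D_def)
    also have "\<dots> = ennreal (c * (1/2) ^ k)"
    proof -
      have "2 ^ k * (c / 4 ^ k) = c * (1/2) ^ k"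
        using power_mult_distrib[of "2::real" 2 k] by (simp add: field_simps power_one_over)
      then show ?thesis using c by (simp flip: ennreal_mult)
    qed
    finally show "(\<integral>\<^sup>+x. ennreal (2 ^ k * (norm (D k x))\<^sup>2) \<partial>N) \<le> ennreal (c * (1/2) ^ k)" .
  qed auto
  also have "\<dots> = ennreal (\<Sum>k. c * (1/2) ^ k)"
    using c by (intro suminf_ennreal2 summable_mult summable_geometric) auto
  also have "\<dots> < \<infinity>" by simp
  finally have "(\<integral>\<^sup>+x. (\<Sum>k. ennreal (2 ^ k * (norm (D k x))\<^sup>2)) \<partial>N) \<noteq> \<infinity>" by simp
  then have "AE x in N. (\<Sum>k. ennreal (2 ^ k * (norm (D k x))\<^sup>2)) \<noteq> \<infinity>"
    by (intro nn_integral_PInf_AE) auto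
  then have conv: "AE x in N. (\<lambda>k. X k x) \<longlonglongrightarrow> lim (\<lambda>k. X k x)"
  proof eventually_elim
    case (elim x)
    have s: "summable (\<lambda>k. 2 ^ k * (norm (D k x))\<^sup>2)"
      using elim by (intro summable_suminf_not_top) auto
    have "summable (\<lambda>k. norm (D k x))"
    proof (rule summable_comparison_test'[where N=0])
      show "summable (\<lambda>k. 2 ^ k * (norm (D k x))\<^sup>2 + (1/2)^k)"
        using s by (intro summable_add summable_geometric) auto
      fix k
      \<comment> \<open>the inequality of arithmetic and geometric means, splitting the factor 1 as \<open>sqrt (2 ^ k) * sqrt ((1/2) ^ k)\<close>\<close>
      have "2 * norm (D k x) \<le> 2 ^ k * (norm (D k x))\<^sup>2 + (1/2)^k"
        using sum_squares_bound[of "sqrt (2 ^ k) * norm (D k x)" "sqrt ((1/2)^k)"]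
        by (simp add: power_mult_distrib real_sqrt_divide power_one_over)
      then show "norm (norm (D k x)) \<le> 2 ^ k * (norm (D k x))\<^sup>2 + (1/2)^k"
        using norm_ge_zero[of "D k x"] unfolding real_norm_def abs_norm_cancel by linarith
    qed
    then have "summable (\<lambda>k. D k x)" by (rule summable_norm_cancel)
    then have "convergent (\<lambda>n. (\<Sum>k<n. D k x) + X 0 x)"
      using summable_iff_convergent convergent_add convergent_const by blast
    then have "convergent (\<lambda>k. X k x)" by (simp add: D_def sum_lessThan_telescope[of "\<lambda>k. X k x" for x])
    then show ?case by (simp add: convergent_LIMSEQ_iff)
  qed
  define Y where "Y x = lim (\<lambda>k. X k x)" for x
  have [measurable]: "Y \<in> borel_measurable N" unfolding Y_def by measurable
  have le: "(\<integral>\<^sup>+x. ennreal ((norm (Y x - X k x))\<^sup>2) \<partial>N) \<le> ennreal (c / 4 ^ k)" for k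
  proof -
    have "(\<integral>\<^sup>+x. ennreal ((norm (Y x - X k x))\<^sup>2) \<partial>N)
        = (\<integral>\<^sup>+x. liminf (\<lambda>j. ennreal ((norm (X j x - X k x))\<^sup>2)) \<partial>N)"
    proof (rule nn_integral_cong_AE, use conv in eventually_elim)
      case (elim x)
      have "(\<lambda>j. ennreal ((norm (X j x - X k x))\<^sup>2)) \<longlonglongrightarrow> ennreal ((norm (Y x - X k x))\<^sup>2)"
        unfolding Y_def by (intro tendsto_intros elim)
      then show ?case using lim_imp_Liminf[OF sequentially_bot] by metis
    qed
    also have "\<dots> \<le> liminf (\<lambda>j. \<integral>\<^sup>+x. ennreal ((norm (X j x - X k x))\<^sup>2) \<partial>N)"
      by (rule nn_integral_liminf) auto
    also have "\<dots> \<le> liminf (\<lambda>j::nat. ennreal (c / 4 ^ k))"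
      by (rule Liminf_mono) (auto simp: eventually_sequentially intro!: exI[of _ k] bnd)
    also have "\<dots> = ennreal (c / 4 ^ k)" by (simp add: Liminf_const)
    finally show ?thesis .
  qed
  have "(\<lambda>k. c * (1/4) ^ k) \<longlonglongrightarrow> c * 0"
    by (intro tendsto_intros LIMSEQ_power_zero) auto
  then have "(\<lambda>k. ennreal (c * (1/4) ^ k)) \<longlonglongrightarrow> ennreal (c * 0)"
    by (rule tendsto_ennrealI)
  then have "(\<lambda>k. ennreal (c / 4 ^ k)) \<longlonglongrightarrow> 0"
    by (simp only: power_one_over mult_zero_right ennreal_0 times_divide_eq_right mult_1_right)
  then have "(\<lambda>k. \<integral>\<^sup>+x. ennreal ((norm (Y x - X k x))\<^sup>2) \<partial>N) \<longlonglongrightarrow> 0"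
    by (rule tendsto_sandwich[OF always_eventually always_eventually tendsto_const, rotated 2])
      (auto intro: le)
  then show thesis by (rule that[rotated]) simp
qed

text \<open>
  The integrals in the hypothesis are eventually finite, so \<open>f\<close> differs by a square integrable
  function from some \<open>f' k\<close>.
\<close>

lemma mean_square_limit:
  fixes f :: "'a \<Rightarrow> 'b::euclidean_space"
  assumes [measurable]: "f \<in> borel_measurable N" "\<And>k. f' k \<in> borel_measurable N"
    and f': "\<And>k. integrable N (\<lambda>x. (norm (f' k x))\<^sup>2)"
    and lim: "(\<lambda>k. \<integral>\<^sup>+x. ennreal ((norm (f x - f' k x))\<^sup>2) \<partial>N) \<longlonglongrightarrow> 0"
  shows "integrable N (\<lambda>x. (norm (f x))\<^sup>2)"
    and "(\<lambda>k. LINT x|N. (norm (f x - f' k x))\<^sup>2) \<longlonglongrightarrow> 0"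
proof -
  have "\<forall>\<^sub>F k in sequentially. (\<integral>\<^sup>+x. ennreal ((norm (f x - f' k x))\<^sup>2) \<partial>N) < 1"
    using lim by (rule order_tendstoD) simp
  then obtain k where "(\<integral>\<^sup>+x. ennreal ((norm (f x - f' k x))\<^sup>2) \<partial>N) < 1"
    using eventually_sequentially by auto
  then have "(\<integral>\<^sup>+x. ennreal ((norm (f x - f' k x))\<^sup>2) \<partial>N) < \<infinity>"
    using order_less_trans by fastforce
  then have i: "integrable N (\<lambda>x. (norm (f x - f' k x))\<^sup>2)"
    by (intro integrableI_bounded) auto
  have "integrable N (\<lambda>x. (norm ((f x - f' k x) - - f' k x))\<^sup>2)"
    by (rule mean_square_integrable_minus) (use i f' in auto)
  then show "integrable N (\<lambda>x. (norm (f x))\<^sup>2)" by simp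
  have "(\<lambda>k. enn2real (\<integral>\<^sup>+x. ennreal ((norm (f x - f' k x))\<^sup>2) \<partial>N)) \<longlonglongrightarrow> 0"
    using tendsto_enn2real[of _ 0] lim by simp
  then show "(\<lambda>k. LINT x|N. (norm (f x - f' k x))\<^sup>2) \<longlonglongrightarrow> 0"
    by (simp add: integral_eq_nn_integral)
qed

section \<open>Covariance of Brownian increments\<close>

text \<open>
  Lebesgue measure on \<open>real^'n\<close> is a product over the basis vectors, so monomial moments of the
  standard normal density (scaled by \<open>\<sigma>\<close>) factor into one-dimensional ones.
\<close>

lemma gaussian_product_moment:
  fixes p :: "'n::finite \<Rightarrow> nat"
  assumes \<sigma>: "0 < \<sigma>"
  shows "has_bochner_integral lborel
      (\<lambda>x::real^'n. \<Prod>i\<in>UNIV. normal_density 0 \<sigma> (x $ i) * (x $ i) ^ p i)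
      (\<Prod>i\<in>UNIV. LINT x|lborel. normal_density 0 \<sigma> x * x ^ p i)"
proof -
  interpret product_sigma_finite "\<lambda>_::real^'n. lborel :: real measure" by standard
  \<comment> \<open>the product measure is indexed by basis vectors, while the integrand is indexed by coordinates; \<open>\<phi>\<close> translates\<close>
  define \<phi> where "\<phi> b = (THE i::'n. b = axis i (1::real))" for b :: "real^'n"
  have \<phi>: "\<phi> (axis i 1) = i" for i
    unfolding \<phi>_def by (rule the_equality) (auto simp: axis_eq_axis)
  have inj: "inj_on (\<lambda>i::'n. axis i (1::real)) UNIV" by (auto simp: inj_on_def axis_eq_axis)
  have B: "(Basis :: (real^'n) set) = range (\<lambda>i. axis i 1)" by (auto simp: Basis_vec_def)
  have eq: "(\<Prod>b\<in>(Basis :: (real^'n) set). F (\<phi> b) (y b)) = (\<Prod>i\<in>UNIV. F i (y (axis i 1)))"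
    for F :: "'n \<Rightarrow> 'c \<Rightarrow> real" and y
    unfolding B by (subst prod.reindex[OF inj]) (simp add: \<phi>)
  let ?g = "\<lambda>i x. normal_density 0 \<sigma> x * x ^ p i"
  have comp: "(\<Sum>b\<in>Basis. f b *\<^sub>R b) $ i = f (axis i 1)" for f and i :: 'n
  proof -
    have "(\<Sum>b\<in>Basis. f b *\<^sub>R b) $ i = (\<Sum>b\<in>Basis. f b *\<^sub>R b) \<bullet> axis i 1"
      by (simp add: inner_axis)
    also have "\<dots> = f (axis i 1)"
      by (subst inner_sum_left_Basis) (auto simp: B)
    finally show ?thesis .
  qed
  have int: "integrable lborel (?g i)" for i
    using integrable_normal_moment[OF \<sigma>, of 0 "p i"] by simp
  have "integrable (\<Pi>\<^sub>M b\<in>(Basis :: (real^'n) set). lborel) (\<lambda>y. \<Prod>b\<in>Basis. ?g (\<phi> b) (y b))"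
    by (rule product_integrable_prod) (auto intro: int)
  moreover have "(LINT y|(\<Pi>\<^sub>M b\<in>(Basis :: (real^'n) set). lborel). (\<Prod>b\<in>Basis. ?g (\<phi> b) (y b)))
      = (\<Prod>b\<in>(Basis :: (real^'n) set). (LINT x|lborel. ?g (\<phi> b) x))"
    by (rule product_integral_prod) (auto intro: int)
  ultimately have "has_bochner_integral (\<Pi>\<^sub>M b\<in>(Basis :: (real^'n) set). lborel)
      (\<lambda>y. \<Prod>i\<in>UNIV. ?g i (y (axis i 1))) (\<Prod>i\<in>UNIV. LINT x|lborel. ?g i x)"
    unfolding has_bochner_integral_iff eq[of ?g] eq[of "\<lambda>i _. LINT x|lborel. ?g i x"] by simp
  then show ?thesis
    by (subst lborel_eq) (auto simp: has_bochner_integral_iff integrable_distr_eq integral_distr comp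
        simp del: sum_component vector_scaleR_component)
qed

lemma gaussian_moments:
  fixes i j :: "'n::finite"
  assumes \<sigma>: "0 < \<sigma>"
  shows "has_bochner_integral lborel
      (\<lambda>x::real^'n. (\<Prod>i\<in>UNIV. normal_density 0 \<sigma> (x $ i)) * x $ i) 0"
    and "has_bochner_integral lborel
      (\<lambda>x::real^'n. (\<Prod>i\<in>UNIV. normal_density 0 \<sigma> (x $ i)) * (x $ i * x $ j))
      (if i = j then \<sigma>\<^sup>2 else 0)"
proof -
  let ?m = "\<lambda>k. LINT x|lborel. normal_density 0 \<sigma> x * x ^ k"
  have m: "integral\<^sup>L lborel (normal_density 0 \<sigma>) = 1" "?m 0 = 1" "?m (Suc 0) = 0" "?m 2 = \<sigma>\<^sup>2"
    using integral_normal_moment_even[OF \<sigma>, of 0 1] integral_normal_moment_odd[OF \<sigma>, of 0 0] \<sigma>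
    by (simp_all add: fact_numeral)
  have one: "(\<Prod>k\<in>UNIV. (x $ k) ^ (if k = l then 1 else 0)) = x $ l" for x :: "real^'n" and l
    by (subst prod.remove[of _ l]) (auto intro!: prod.neutral)
  have "(\<Prod>k\<in>UNIV. ?m (if k = i then 1 else 0)) = 0"
    by (intro prod_zero bexI[of _ i]) (use m in auto)
  with gaussian_product_moment[OF \<sigma>, of "\<lambda>k. if k = i then 1 else 0"]
  show "has_bochner_integral lborel
      (\<lambda>x::real^'n. (\<Prod>i\<in>UNIV. normal_density 0 \<sigma> (x $ i)) * x $ i) 0"
    unfolding prod.distrib one by (simp only:)
  let ?p = "\<lambda>k. (if k = i then 1 else 0) + (if k = j then 1 else 0)"
  have "(\<Prod>k\<in>UNIV. ?m (?p k)) = (if i = j then \<sigma>\<^sup>2 else 0)"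
  proof (cases "i = j")
    case True
    then show ?thesis by (subst prod.remove[of _ i]) (auto intro!: prod.neutral simp: m numeral_2_eq_2[symmetric])
  next
    case False
    then show ?thesis by (intro trans[OF prod_zero] bexI[of _ i]) (use m in auto)
  qed
  then show "has_bochner_integral lborel
      (\<lambda>x::real^'n. (\<Prod>i\<in>UNIV. normal_density 0 \<sigma> (x $ i)) * (x $ i * x $ j))
      (if i = j then \<sigma>\<^sup>2 else 0)"
    using gaussian_product_moment[OF \<sigma>, of ?p]
    unfolding prod.distrib one power_add by simp
qed

lemma borel_measurable_component [measurable (raw)]:
  fixes f :: "'a \<Rightarrow> real^'n"
  assumes "f \<in> borel_measurable N"
  shows "(\<lambda>x. f x $ i) \<in> borel_measurable N"
  using borel_measurable_inner[OF assms borel_measurable_const, of "axis i 1"]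
  by (simp add: inner_axis)

context standard_brownian_motion
begin

lemma increment_expectation:
  fixes g :: "real^'n \<Rightarrow> real"
  assumes "0 \<le> s" "s < t" and g: "g \<in> borel_measurable borel"
    and v: "has_bochner_integral lborel
      (\<lambda>x. (\<Prod>i\<in>UNIV. normal_density 0 (sqrt (t - s)) (x $ i)) * g x) v"
  shows "has_bochner_integral M (\<lambda>\<omega>. g (B t \<omega> - B s \<omega>)) v"
proof -
  note d = gaussian_increments[OF assms(1,2)]
  have nn: "0 \<le> (\<Prod>i\<in>UNIV. normal_density 0 (sqrt (t - s)) (x $ i))" for x :: "real^'n"
    by (auto intro!: prod_nonneg)
  show ?thesis
    using v distributed_integrable[OF d, of g] distributed_integral[OF d, of g] g nn
    by (simp add: has_bochner_integral_iff)
qed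

lemma increment_moments:
  assumes "0 \<le> s" "s < t"
  shows "has_bochner_integral M (\<lambda>\<omega>. (B t \<omega> - B s \<omega>) $ i) 0"
    and "has_bochner_integral M (\<lambda>\<omega>. (B t \<omega> - B s \<omega>) $ i * (B t \<omega> - B s \<omega>) $ j)
      (if i = j then t - s else 0)"
proof -
  have \<sigma>: "0 < sqrt (t - s)" using assms by simp
  show "has_bochner_integral M (\<lambda>\<omega>. (B t \<omega> - B s \<omega>) $ i) 0"
    by (rule increment_expectation[OF assms, of "\<lambda>x. x $ i", OF _ gaussian_moments(1)[OF \<sigma>]]) auto
  have "has_bochner_integral lborel
      (\<lambda>x::real^'n. (\<Prod>i\<in>UNIV. normal_density 0 (sqrt (t - s)) (x $ i)) * (x $ i * x $ j))
      (if i = j then t - s else 0)"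
    using gaussian_moments(2)[OF \<sigma>, of i j] assms by (cases "i = j") auto
  then show "has_bochner_integral M (\<lambda>\<omega>. (B t \<omega> - B s \<omega>) $ i * (B t \<omega> - B s \<omega>) $ j)
      (if i = j then t - s else 0)"
    by (rule increment_expectation[OF assms, of "\<lambda>x. x $ i * x $ j", rotated]) auto
qed

text \<open>
  For \<open>0 < s < t\<close> split \<open>B t = B s + (B t - B s)\<close>: the cross term vanishes because \<open>B s = B s - B 0\<close>
  almost surely is independent of the centred increment \<open>B t - B s\<close>.
\<close>

lemma covariance_ordered:
  assumes "0 \<le> s" "s \<le> t"
  shows "has_bochner_integral M (\<lambda>\<omega>. B s \<omega> $ i * B t \<omega> $ j) (if i = j then s else 0)"
proof (cases "s = 0")
  case True
  have [measurable]: "random_variable borel (B s)" "random_variable borel (B t)"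
    using assms random_variable_B by auto
  have m: "(\<lambda>\<omega>. B s \<omega> $ i * B t \<omega> $ j) \<in> borel_measurable M"
    by (intro borel_measurable_times borel_measurable_component) measurable
  have "AE \<omega> in M. B s \<omega> $ i * B t \<omega> $ j = 0"
    using B_0 by eventually_elim (simp add: True)
  then have "has_bochner_integral M (\<lambda>\<omega>. B s \<omega> $ i * B t \<omega> $ j) 0
      \<longleftrightarrow> has_bochner_integral M (\<lambda>\<omega>. 0::real) 0"
    by (intro has_bochner_integral_cong_AE m) auto
  then show ?thesis using True by (cases "i = j") auto
next
  case False
  then have s: "0 < s" using assms by simp
  have [measurable]: "random_variable borel (B s)" "random_variable borel (B t)"
    "random_variable borel (B 0)"
    using assms random_variable_B by auto
  have var: "has_bochner_integral M (\<lambda>\<omega>. B s \<omega> $ i * B s \<omega> $ j) (if i = j then s else 0)"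
  proof -
    have "has_bochner_integral M (\<lambda>\<omega>. (B s \<omega> - B 0 \<omega>) $ i * (B s \<omega> - B 0 \<omega>) $ j)
        (if i = j then s - 0 else 0)"
      by (rule increment_moments) (use s in auto)
    also have "?this \<longleftrightarrow> has_bochner_integral M (\<lambda>\<omega>. B s \<omega> $ i * B s \<omega> $ j) (if i = j then s - 0 else 0)"
      by (intro has_bochner_integral_cong_AE) (use B_0 in auto)
    finally show ?thesis by (cases "i = j") auto
  qed
  show ?thesis
  proof (cases "s = t")
    case True
    then show ?thesis using var by simp
  next
    case False
    then have st: "s < t" using assms by simp
    \<comment> \<open>only the times 0, s and t matter; the sequence continues arbitrarily, as independence is tested on infinite strictly increasing sequences\<close>
    define \<tau> where "\<tau> n = (if n = 0 then 0 else if n = 1 then s else t + real n - 2)" for n :: nat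
    have mono: "strict_mono \<tau>"
      unfolding strict_mono_Suc_iff \<tau>_def using s st by (auto simp: numeral_2_eq_2)
    have "indep_vars (\<lambda>_. borel) (\<lambda>k \<omega>. B (\<tau> (Suc k)) \<omega> - B (\<tau> k) \<omega>) {..<2}"
      by (rule independent_increments[OF mono]) (simp add: \<tau>_def)
    then have ind: "indep_vars (\<lambda>_. borel)
        (\<lambda>k \<omega>. (B (\<tau> (Suc k)) \<omega> - B (\<tau> k) \<omega>) $ (if k = 0 then i else j)) {..<2}"
      by (rule indep_vars_compose2) auto
    have two: "{..<2} = {0, 1::nat}" by auto
    have \<tau>: "\<tau> 0 = 0" "\<tau> 1 = s" "\<tau> (Suc 0) = s" "\<tau> (Suc (Suc 0)) = t" by (auto simp: \<tau>_def)
    have int: "integrable M (\<lambda>\<omega>. (B (\<tau> (Suc k)) \<omega> - B (\<tau> k) \<omega>) $ (if k = 0 then i else j))"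
      if "k \<in> {..<2}" for k
      using that increment_moments(1)[of 0 s i] increment_moments(1)[of s t j] s st
      by (auto simp: two \<tau> has_bochner_integral_iff)
    have "has_bochner_integral M (\<lambda>\<omega>. (B s \<omega> - B 0 \<omega>) $ i * (B t \<omega> - B s \<omega>) $ j) 0"
      using indep_vars_lebesgue_integral[OF _ ind int] indep_vars_integrable[OF _ ind int]
        increment_moments(1)[of 0 s i] s
      by (simp add: two \<tau> has_bochner_integral_iff)
    also have "?this \<longleftrightarrow> has_bochner_integral M (\<lambda>\<omega>. B s \<omega> $ i * (B t \<omega> - B s \<omega>) $ j) 0"
      by (intro has_bochner_integral_cong_AE) (use B_0 in auto)
    finally show ?thesis
      using has_bochner_integral_add[OF var] by (fastforce simp: algebra_simps)
  qed
qed

lemma covariance: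
  assumes "0 \<le> s" "0 \<le> t"
  shows "has_bochner_integral M (\<lambda>\<omega>. B s \<omega> $ i * B t \<omega> $ j) (if i = j then min s t else 0)"
proof (cases "s \<le> t")
  case True
  then show ?thesis using covariance_ordered[of s t i j] assms by (cases "i = j") auto
next
  case False
  then show ?thesis using covariance_ordered[of t s j i] assms
    by (cases "i = j") (auto simp: min_def mult.commute)
qed

end

lemma outer_prod_nth: "outer_prod x y $ i $ j = x $ i * y $ j"
  by (simp add: outer_prod_def matrix_matrix_mult_def columnvector_def rowvector_def)

lemma has_bochner_integral_matrix:
  fixes f :: "'a \<Rightarrow> real^'n^'m"
  assumes "\<And>i j. has_bochner_integral N (\<lambda>x. f x $ i $ j) (V $ i $ j)"
  shows "has_bochner_integral N f V"
proof -
  have eq: "W = (\<Sum>i\<in>UNIV. \<Sum>j\<in>UNIV. W $ i $ j *\<^sub>R axis i (axis j 1))" for W :: "real^'n^'m"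
  proof -
    have ax: "axis i (axis j (1::real)) $ k $ l = (if k = i then if l = j then 1 else 0 else 0)"
      for i k :: 'm and j l :: 'n
      by (simp add: axis_def)
    have "(\<Sum>i\<in>UNIV. \<Sum>j\<in>UNIV. W $ i $ j *\<^sub>R axis i (axis j 1)) $ k $ l = W $ k $ l" for k l
    proof -
      have "(\<Sum>i\<in>UNIV. \<Sum>j\<in>UNIV. W $ i $ j *\<^sub>R axis i (axis j 1)) $ k $ l
          = (\<Sum>i\<in>UNIV. if k = i then \<Sum>j\<in>UNIV. if l = j then W $ i $ j else 0 else 0)"
        unfolding sum_component vector_scaleR_component ax
      proof (rule sum.cong[OF refl])
        fix i
        show "(\<Sum>j\<in>UNIV. W $ i $ j *\<^sub>R (if k = i then if l = j then 1 else 0 else 0))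
            = (if k = i then \<Sum>j\<in>UNIV. if l = j then W $ i $ j else 0 else 0)"
          by (cases "k = i") (simp_all add: if_distrib[of "\<lambda>x. _ * x"] cong: if_cong)
      qed
      then show ?thesis by simp
    qed
    then show ?thesis by (simp add: vec_eq_iff)
  qed
  have "has_bochner_integral N (\<lambda>x. \<Sum>i\<in>UNIV. \<Sum>j\<in>UNIV. f x $ i $ j *\<^sub>R axis i (axis j 1))
      (\<Sum>i\<in>UNIV. \<Sum>j\<in>UNIV. V $ i $ j *\<^sub>R axis i (axis j (1::real)))"
    by (intro has_bochner_integral_sum has_bochner_integral_scaleR_left assms)
  then show ?thesis unfolding eq[symmetric] .
qed

text \<open>
  White-noise form of the covariance: two increments correlate by the length of the overlap of
  their time intervals. In this form the isometry for step integrands on two different partitions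
  needs no common refinement.
\<close>

lemma (in standard_brownian_motion) increment_covariance:
  assumes "0 \<le> a" "a \<le> b" "0 \<le> c" "c \<le> d"
  shows "has_bochner_integral M (\<lambda>\<omega>. outer_prod (B b \<omega> - B a \<omega>) (B d \<omega> - B c \<omega>))
    (measure lborel ({a<..b} \<inter> {c<..d}) *\<^sub>R mat 1)"
proof (rule has_bochner_integral_matrix)
  fix i j
  have "{a<..b} \<inter> {c<..d} = {max a c<..min b d}" by auto
  then have m: "measure lborel ({a<..b} \<inter> {c<..d}) = min b d - min b c - (min a d - min a c)"
    using assms by (cases "max a c \<le> min b d") (auto simp: min_def max_def split: if_splits)
  have "has_bochner_integral M
     (\<lambda>\<omega>. (B b \<omega> $ i * B d \<omega> $ j - B b \<omega> $ i * B c \<omega> $ j) - (B a \<omega> $ i * B d \<omega> $ j - B a \<omega> $ i * B c \<omega> $ j))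
     (((if i = j then min b d else 0) - (if i = j then min b c else 0))
       - ((if i = j then min a d else 0) - (if i = j then min a c else 0)))"
    by (intro has_bochner_integral_diff covariance) (use assms in auto)
  then show "has_bochner_integral M (\<lambda>\<omega>. outer_prod (B b \<omega> - B a \<omega>) (B d \<omega> - B c \<omega>) $ i $ j)
      ((measure lborel ({a<..b} \<inter> {c<..d}) *\<^sub>R mat 1) $ i $ j)"
    unfolding m outer_prod_nth by (simp add: mat_def algebra_simps split: if_splits)
qed

section \<open>The isometry for step integrands\<close>

lemma bounded_bilinear_outer_prod:
  "bounded_bilinear (outer_prod :: real^'n \<Rightarrow> real^'m \<Rightarrow> real^'m^'n)"
  unfolding bilinear_conv_bounded_bilinear[symmetric] bilinear_def
  by (auto intro!: linearI simp: vec_eq_iff outer_prod_nth algebra_simps)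

lemma bounded_bilinear_matrix_mult:
  "bounded_bilinear ((**) :: real^'n^'m \<Rightarrow> real^'p^'n \<Rightarrow> real^'p^'m)"
  unfolding bilinear_conv_bounded_bilinear[symmetric] bilinear_def
  by (auto intro!: linearI simp: vec_eq_iff matrix_matrix_mult_def algebra_simps sum.distrib sum_distrib_left)

lemma bounded_linear_transpose: "bounded_linear (transpose :: real^'n^'m \<Rightarrow> real^'m^'n)"
  unfolding linear_conv_bounded_linear[symmetric]
  by (auto intro!: linearI simp: vec_eq_iff transpose_def)

lemma bounded_bilinear_mult_transpose:
  "bounded_bilinear (\<lambda>X Y. (X :: real^'n^'m) ** transpose (Y :: real^'n^'p))"
  by (rule bounded_bilinear.comp[OF bounded_bilinear_matrix_mult bounded_linear_ident bounded_linear_transpose])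

lemma bounded_linear_trace: "bounded_linear (trace :: real^'n^'n \<Rightarrow> real)"
  unfolding linear_conv_bounded_linear[symmetric]
  by (auto intro!: linearI simp: trace_def sum.distrib sum_distrib_left)

lemma trace_outer_prod: "trace (outer_prod x y) = x \<bullet> y"
  by (simp add: trace_def outer_prod_nth inner_vec_def)

lemma trace_mult_transpose: "trace (X ** transpose Y) = X \<bullet> (Y :: real^'n^'m)"
  by (simp add: trace_def matrix_matrix_mult_def transpose_def inner_vec_def)

lemma outer_prod_matrix_vector_mult:
  fixes C :: "real^'n^'m" and D :: "real^'k^'l"
  shows "outer_prod (C *v x) (D *v y) = C ** outer_prod x y ** transpose D"
proof -
  have "(\<Sum>p\<in>UNIV. C $ i $ p * x $ p) * (\<Sum>q\<in>UNIV. D $ j $ q * y $ q)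
      = (\<Sum>q\<in>UNIV. (\<Sum>p\<in>UNIV. C $ i $ p * (x $ p * y $ q)) * D $ j $ q)" for i j
    by (subst sum_product, subst sum.swap) (simp add: sum_distrib_right sum_distrib_left algebra_simps)
  then show ?thesis
    by (simp add: vec_eq_iff outer_prod_nth matrix_vector_mult_def matrix_matrix_mult_def transpose_def)
qed

lemma borel_measurable_matrix_vector_mult [measurable (raw)]:
  fixes f :: "'a \<Rightarrow> real^'n" and C :: "real^'n^'m"
  assumes "f \<in> borel_measurable N"
  shows "(\<lambda>x. C *v f x) \<in> borel_measurable N"
  by (rule measurable_compose[OF assms borel_measurable_continuous_onI])
     (intro linear_continuous_on matrix_vector_mul_bounded_linear)

lemma step_integrand_measurable [measurable]: "step_integrand \<tau> C n \<in> borel_measurable borel"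
  unfolding step_integrand_def by measurable

lemma step_integrand_outside:
  assumes "range \<tau> \<subseteq> {a..b}" "s \<notin> {a<..b}"
  shows "step_integrand \<tau> C n s = 0"
proof -
  have "s \<notin> {\<tau> i<..\<tau> (Suc i)}" for i
  proof -
    have "\<tau> i \<in> {a..b}" "\<tau> (Suc i) \<in> {a..b}" using assms(1) by blast+
    then show ?thesis using assms(2) by auto
  qed
  then show ?thesis by (simp add: step_integrand_def)
qed

context standard_brownian_motion
begin

lemma step_integral_measurable:
  assumes "range \<tau> \<subseteq> {0..}"
  shows "step_integral B \<tau> C n \<in> borel_measurable M"
proof -
  have [measurable]: "random_variable borel (B (\<tau> i))" for i
    using assms by (intro random_variable_B) auto
  show ?thesis unfolding step_integral_def by measurable
qed

text \<open>
  Polarised Ito isometry for step integrands. Both integrals have the same double sum as value,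
  because the overlap lengths of the partition intervals arise both as covariances of increments and
  as integrals of products of indicators.
\<close>

lemma step_covariance:
  fixes C :: "nat \<Rightarrow> real^'n^'m" and D :: "nat \<Rightarrow> real^'n^'p"
  assumes "mono \<tau>" "range \<tau> \<subseteq> {0..}" "mono \<sigma>" "range \<sigma> \<subseteq> {0..}"
  shows "\<exists>V. has_bochner_integral M
        (\<lambda>\<omega>. outer_prod (step_integral B \<tau> C n \<omega>) (step_integral B \<sigma> D m \<omega>)) V
      \<and> has_bochner_integral lborel
        (\<lambda>s. step_integrand \<tau> C n s ** transpose (step_integrand \<sigma> D m s)) V"
proof -
  let ?A = "\<lambda>i. {\<tau> i<..\<tau> (Suc i)}" and ?B = "\<lambda>j. {\<sigma> j<..\<sigma> (Suc j)}"
  let ?\<mu> = "\<lambda>i j. measure lborel (?A i \<inter> ?B j)"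
  let ?V = "\<Sum>i<n. \<Sum>j<m. ?\<mu> i j *\<^sub>R (C i ** transpose (D j))"
  have ord: "0 \<le> \<tau> i" "\<tau> i \<le> \<tau> (Suc i)" "0 \<le> \<sigma> i" "\<sigma> i \<le> \<sigma> (Suc i)" for i
    using rangeI[of \<tau> i] rangeI[of \<sigma> i] assms(2,4) monoD[OF assms(1), of i "Suc i"]
      monoD[OF assms(3), of i "Suc i"] by auto
  interpret O: bounded_bilinear "outer_prod :: real^'m \<Rightarrow> real^'p \<Rightarrow> _"
    by (rule bounded_bilinear_outer_prod)
  interpret T: bounded_bilinear "\<lambda>X Y. (X :: real^'n^'m) ** transpose (Y :: real^'n^'p)"
    by (rule bounded_bilinear_mult_transpose)
  have bl: "bounded_linear (\<lambda>W :: real^'n^'n. C i ** W ** transpose (D j))" for i j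
    using bounded_linear_compose[OF
        bounded_bilinear.bounded_linear_left[OF bounded_bilinear_matrix_mult, of "transpose (D j)"]
        bounded_bilinear.bounded_linear_right[OF bounded_bilinear_matrix_mult, of "C i"]]
    by (simp add: o_def)
  have V: "C i ** (?\<mu> i j *\<^sub>R mat 1) ** transpose (D j) = ?\<mu> i j *\<^sub>R (C i ** transpose (D j))" for i j
    using linear_scale[OF bounded_linear.linear[OF bl[of i j]], of "?\<mu> i j" "mat 1"] by simp
  have "has_bochner_integral M (\<lambda>\<omega>. \<Sum>i<n. \<Sum>j<m. C i **
      outer_prod (B (\<tau> (Suc i)) \<omega> - B (\<tau> i) \<omega>) (B (\<sigma> (Suc j)) \<omega> - B (\<sigma> j) \<omega>) ** transpose (D j)) ?V"
    unfolding V[symmetric]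
    by (intro has_bochner_integral_sum has_bochner_integral_bounded_linear[OF bl]
        increment_covariance ord)
  moreover have "outer_prod (step_integral B \<tau> C n \<omega>) (step_integral B \<sigma> D m \<omega>) = (\<Sum>i<n. \<Sum>j<m. C i **
      outer_prod (B (\<tau> (Suc i)) \<omega> - B (\<tau> i) \<omega>) (B (\<sigma> (Suc j)) \<omega> - B (\<sigma> j) \<omega>) ** transpose (D j))" for \<omega>
    unfolding step_integral_def
    by (subst O.sum_left) (simp only: O.sum_right outer_prod_matrix_vector_mult)
  ultimately have M: "has_bochner_integral M
      (\<lambda>\<omega>. outer_prod (step_integral B \<tau> C n \<omega>) (step_integral B \<sigma> D m \<omega>)) ?V"
    by simp
  have "has_bochner_integral lborel (\<lambda>s. \<Sum>i<n. \<Sum>j<m.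
      (indicator (?A i \<inter> ?B j) s :: real) *\<^sub>R (C i ** transpose (D j))) ?V"
  proof (intro has_bochner_integral_sum has_bochner_integral_scaleR_left has_bochner_integral_real_indicator)
    fix i j
    have "emeasure lborel (?A i \<inter> ?B j) \<le> emeasure lborel (?A i)"
      by (intro emeasure_mono) auto
    also have "\<dots> < \<infinity>" using ord by simp
    finally show "emeasure lborel (?A i \<inter> ?B j) < \<infinity>" .
  qed auto
  moreover have "step_integrand \<tau> C n s ** transpose (step_integrand \<sigma> D m s) = (\<Sum>i<n. \<Sum>j<m.
      (indicator (?A i \<inter> ?B j) s :: real) *\<^sub>R (C i ** transpose (D j)))" for s
    unfolding step_integrand_def
    by (subst T.sum_left)
       (simp only: T.sum_right T.scaleR_left T.scaleR_right scaleR_scaleR indicator_inter_arith mult.commute)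
  ultimately have "has_bochner_integral lborel
        (\<lambda>s. step_integrand \<tau> C n s ** transpose (step_integrand \<sigma> D m s)) ?V"
    by simp
  with M show ?thesis by blast
qed

lemma step_inner:
  fixes C :: "nat \<Rightarrow> real^'n^'m" and D :: "nat \<Rightarrow> real^'n^'m"
  assumes "mono \<tau>" "range \<tau> \<subseteq> {0..}" "mono \<sigma>" "range \<sigma> \<subseteq> {0..}"
  shows "\<exists>v. has_bochner_integral M (\<lambda>\<omega>. step_integral B \<tau> C n \<omega> \<bullet> step_integral B \<sigma> D m \<omega>) v
      \<and> has_bochner_integral lborel (\<lambda>s. step_integrand \<tau> C n s \<bullet> step_integrand \<sigma> D m s) v"
proof -
  obtain V where V: "has_bochner_integral M
        (\<lambda>\<omega>. outer_prod (step_integral B \<tau> C n \<omega>) (step_integral B \<sigma> D m \<omega>)) V"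
      "has_bochner_integral lborel
        (\<lambda>s. step_integrand \<tau> C n s ** transpose (step_integrand \<sigma> D m s)) V"
    using step_covariance[OF assms] by blast
  show ?thesis
    using has_bochner_integral_bounded_linear[OF bounded_linear_trace V(1)]
      has_bochner_integral_bounded_linear[OF bounded_linear_trace V(2)]
    unfolding trace_outer_prod trace_mult_transpose by blast
qed

text \<open>
  The traces of the two matrix integrals in the polarised isometry are inner products, so expanding
  the squared norm of a difference gives the usual isometry.
\<close>

lemma step_isometry:
  fixes C :: "nat \<Rightarrow> real^'n^'m" and D :: "nat \<Rightarrow> real^'n^'m"
  assumes "mono \<tau>" "range \<tau> \<subseteq> {0..}" "mono \<sigma>" "range \<sigma> \<subseteq> {0..}"
  shows "(\<integral>\<^sup>+\<omega>. ennreal ((norm (step_integral B \<tau> C n \<omega> - step_integral B \<sigma> D m \<omega>))\<^sup>2) \<partial>M)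
      = (\<integral>\<^sup>+s. ennreal ((norm (step_integrand \<tau> C n s - step_integrand \<sigma> D m s))\<^sup>2) \<partial>lborel)"
proof -
  obtain u where
    u: "has_bochner_integral M (\<lambda>\<omega>. step_integral B \<tau> C n \<omega> \<bullet> step_integral B \<tau> C n \<omega>) u"
      "has_bochner_integral lborel (\<lambda>s. step_integrand \<tau> C n s \<bullet> step_integrand \<tau> C n s) u"
    using step_inner[OF assms(1,2,1,2)] by blast
  obtain v where
    v: "has_bochner_integral M (\<lambda>\<omega>. step_integral B \<tau> C n \<omega> \<bullet> step_integral B \<sigma> D m \<omega>) v"
      "has_bochner_integral lborel (\<lambda>s. step_integrand \<tau> C n s \<bullet> step_integrand \<sigma> D m s) v"
    using step_inner[OF assms] by blast
  obtain w where
    w: "has_bochner_integral M (\<lambda>\<omega>. step_integral B \<sigma> D m \<omega> \<bullet> step_integral B \<sigma> D m \<omega>) w"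
      "has_bochner_integral lborel (\<lambda>s. step_integrand \<sigma> D m s \<bullet> step_integrand \<sigma> D m s) w"
    using step_inner[OF assms(3,4,3,4)] by blast
  have eq: "(norm (x - y))\<^sup>2 = x \<bullet> x - 2 * (x \<bullet> y) + y \<bullet> y" for x y :: "'b::real_inner"
    by (simp add: power2_norm_eq_inner inner_diff inner_commute)
  have "has_bochner_integral M
      (\<lambda>\<omega>. (norm (step_integral B \<tau> C n \<omega> - step_integral B \<sigma> D m \<omega>))\<^sup>2) (u - 2 * v + w)"
    unfolding eq using u v w
    by (intro has_bochner_integral_add has_bochner_integral_diff has_bochner_integral_mult_right)
  moreover have "has_bochner_integral lborel
      (\<lambda>s. (norm (step_integrand \<tau> C n s - step_integrand \<sigma> D m s))\<^sup>2) (u - 2 * v + w)"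
    unfolding eq using u v w
    by (intro has_bochner_integral_add has_bochner_integral_diff has_bochner_integral_mult_right)
  ultimately show ?thesis
    by (simp add: has_bochner_integral_iff nn_integral_eq_integral)
qed

end

section \<open>Covariance of Wiener integrals\<close>

text \<open>
  Extending the integrand by zero moves the approximation from \<open>{a<..<b}\<close> to the whole line, where
  integrands living on different intervals can be compared. The point \<open>b\<close>, where the step integrand
  need not vanish, is a null set.
\<close>

lemma nn_integral_Ioo_step:
  fixes F :: "real \<Rightarrow> real^'n^'m"
  assumes "range \<tau> \<subseteq> {a..b}"
  shows "(\<integral>\<^sup>+ s \<in> {a<..<b}. ennreal ((norm (F s - step_integrand \<tau> C n s))\<^sup>2) \<partial>lborel)
    = (\<integral>\<^sup>+ s. ennreal ((norm (indicator {a<..<b} s *\<^sub>R F s - step_integrand \<tau> C n s))\<^sup>2) \<partial>lborel)"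
proof (rule nn_integral_cong_AE)
  show "AE s in lborel. ennreal ((norm (F s - step_integrand \<tau> C n s))\<^sup>2) * indicator {a<..<b} s
      = ennreal ((norm (indicator {a<..<b} s *\<^sub>R F s - step_integrand \<tau> C n s))\<^sup>2)"
    using AE_lborel_singleton[of b]
  proof eventually_elim
    case (elim s)
    then show ?case
      using step_integrand_outside[OF assms, of s C n]
      by (cases "s \<in> {a<..<b}") (auto simp: indicator_def)
  qed
qed

context standard_brownian_motion
begin

lemma wiener_integral_approximation:
  fixes F :: "real \<Rightarrow> real^'n^'m"
  assumes I: "has_wiener_integral M B a b F I" and "0 \<le> a"
  obtains \<tau> C n where "\<forall>k. mono (\<tau> k)" "\<forall>k. range (\<tau> k) \<subseteq> {0..}"
    "\<forall>k. integrable lborel (\<lambda>s. (norm (step_integrand (\<tau> k) (C k) (n k) s))\<^sup>2)"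
    "\<forall>k. integrable M (\<lambda>\<omega>. (norm (step_integral B (\<tau> k) (C k) (n k) \<omega>))\<^sup>2)"
    "(\<lambda>k. LINT s|lborel. (norm (indicator {a<..<b} s *\<^sub>R F s
        - step_integrand (\<tau> k) (C k) (n k) s))\<^sup>2) \<longlonglongrightarrow> 0"
    "(\<lambda>k. LINT \<omega>|M. (norm (I \<omega> - step_integral B (\<tau> k) (C k) (n k) \<omega>))\<^sup>2) \<longlonglongrightarrow> 0"
    "integrable lborel (\<lambda>s. (norm (indicator {a<..<b} s *\<^sub>R F s))\<^sup>2)"
    "integrable M (\<lambda>\<omega>. (norm (I \<omega>))\<^sup>2)"
proof -
  obtain \<tau> C n where \<tau>: "\<And>k. mono (\<tau> k)" "\<And>k. range (\<tau> k) \<subseteq> {a..b}" and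
    l1: "(\<lambda>k. \<integral>\<^sup>+ s \<in> {a<..<b}. ennreal ((norm (F s - step_integrand (\<tau> k) (C k) (n k) s))\<^sup>2) \<partial>lborel)
          \<longlonglongrightarrow> 0" and
    l2: "(\<lambda>k. \<integral>\<^sup>+ \<omega>. ennreal ((norm (I \<omega> - step_integral B (\<tau> k) (C k) (n k) \<omega>))\<^sup>2) \<partial>M) \<longlonglongrightarrow> 0"
    and [measurable]: "I \<in> borel_measurable M" and F: "square_integrable_on F {a<..<b}"
    using I unfolding has_wiener_integral_def by blast
  have \<tau>0: "range (\<tau> k) \<subseteq> {0..}" for k by (rule order_trans[OF \<tau>(2)]) (use \<open>0 \<le> a\<close> in auto)
  have [measurable]: "step_integral B (\<tau> k) (C k) (n k) \<in> borel_measurable M" for k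
    by (rule step_integral_measurable[OF \<tau>0])
  have [measurable]: "(\<lambda>s. indicator {a<..<b} s *\<^sub>R F s) \<in> borel_measurable lborel"
    using F by (simp add: square_integrable_on_def set_borel_measurable_def)
  have i: "integrable lborel (\<lambda>s. (norm (step_integrand (\<tau> k) (C k) (n k) s))\<^sup>2)"
    "integrable M (\<lambda>\<omega>. (norm (step_integral B (\<tau> k) (C k) (n k) \<omega>))\<^sup>2)" for k
    using step_inner[OF \<tau>(1) \<tau>0 \<tau>(1) \<tau>0, of k "C k" "n k" k "C k" "n k"]
    by (auto simp: power2_norm_eq_inner has_bochner_integral_iff)
  note l1 = l1[unfolded nn_integral_Ioo_step[OF \<tau>(2)]]
  have "\<forall>k. mono (\<tau> k)" "\<forall>k. range (\<tau> k) \<subseteq> {0..}"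
    "\<forall>k. integrable lborel (\<lambda>s. (norm (step_integrand (\<tau> k) (C k) (n k) s))\<^sup>2)"
    "\<forall>k. integrable M (\<lambda>\<omega>. (norm (step_integral B (\<tau> k) (C k) (n k) \<omega>))\<^sup>2)"
    using \<tau>(1) \<tau>0 i by blast+
  then show thesis
    by (rule that) (rule mean_square_limit[OF _ _ i(1) l1] mean_square_limit[OF _ _ i(2) l2]; measurable)+
qed

text \<open>
  The isometry for Wiener integrals over possibly different intervals; it holds for every version of
  the integrals and every choice of approximating step integrands, since both sides are mean-square
  limits of the two sides of the step isometry.
\<close>

theorem wiener_integral_covariance:
  fixes F :: "real \<Rightarrow> real^'n^'m" and G :: "real \<Rightarrow> real^'n^'p"
  assumes I: "has_wiener_integral M B a b F I" and J: "has_wiener_integral M B c d G J"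
    and "0 \<le> a" "0 \<le> c"
  shows "integrable M (\<lambda>\<omega>. outer_prod (I \<omega>) (J \<omega>))"
    and "set_integrable lborel ({a<..<b} \<inter> {c<..<d}) (\<lambda>s. F s ** transpose (G s))"
    and "(LINT \<omega>|M. outer_prod (I \<omega>) (J \<omega>))
      = (LINT s:{a<..<b} \<inter> {c<..<d}|lborel. F s ** transpose (G s))"
proof -
  obtain \<tau> C n where t: "\<forall>k. mono (\<tau> k)" "\<forall>k. range (\<tau> k) \<subseteq> {0..}"
    "\<forall>k. integrable lborel (\<lambda>s. (norm (step_integrand (\<tau> k) (C k) (n k) s))\<^sup>2)"
    "\<forall>k. integrable M (\<lambda>\<omega>. (norm (step_integral B (\<tau> k) (C k) (n k) \<omega>))\<^sup>2)"
    "(\<lambda>k. LINT s|lborel. (norm (indicator {a<..<b} s *\<^sub>R F s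
        - step_integrand (\<tau> k) (C k) (n k) s))\<^sup>2) \<longlonglongrightarrow> 0"
    "(\<lambda>k. LINT \<omega>|M. (norm (I \<omega> - step_integral B (\<tau> k) (C k) (n k) \<omega>))\<^sup>2) \<longlonglongrightarrow> 0"
    "integrable lborel (\<lambda>s. (norm (indicator {a<..<b} s *\<^sub>R F s))\<^sup>2)"
    "integrable M (\<lambda>\<omega>. (norm (I \<omega>))\<^sup>2)"
    by (rule wiener_integral_approximation[OF I \<open>0 \<le> a\<close>])
  note t = t[rule_format]
  obtain \<sigma> D m where u: "\<forall>k. mono (\<sigma> k)" "\<forall>k. range (\<sigma> k) \<subseteq> {0..}"
    "\<forall>k. integrable lborel (\<lambda>s. (norm (step_integrand (\<sigma> k) (D k) (m k) s))\<^sup>2)"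
    "\<forall>k. integrable M (\<lambda>\<omega>. (norm (step_integral B (\<sigma> k) (D k) (m k) \<omega>))\<^sup>2)"
    "(\<lambda>k. LINT s|lborel. (norm (indicator {c<..<d} s *\<^sub>R G s
        - step_integrand (\<sigma> k) (D k) (m k) s))\<^sup>2) \<longlonglongrightarrow> 0"
    "(\<lambda>k. LINT \<omega>|M. (norm (J \<omega> - step_integral B (\<sigma> k) (D k) (m k) \<omega>))\<^sup>2) \<longlonglongrightarrow> 0"
    "integrable lborel (\<lambda>s. (norm (indicator {c<..<d} s *\<^sub>R G s))\<^sup>2)"
    "integrable M (\<lambda>\<omega>. (norm (J \<omega>))\<^sup>2)"
    by (rule wiener_integral_approximation[OF J \<open>0 \<le> c\<close>])
  note u = u[rule_format]
  have [measurable]: "I \<in> borel_measurable M" "J \<in> borel_measurable M"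
    "(\<lambda>s. indicator {a<..<b} s *\<^sub>R F s) \<in> borel_measurable lborel"
    "(\<lambda>s. indicator {c<..<d} s *\<^sub>R G s) \<in> borel_measurable lborel"
    using I J
    by (auto simp: has_wiener_integral_def square_integrable_on_def set_borel_measurable_def)
  have [measurable]: "step_integral B (\<tau> k) (C k) (n k) \<in> borel_measurable M"
    "step_integral B (\<sigma> k) (D k) (m k) \<in> borel_measurable M"
    for k
    using step_integral_measurable[OF t(2)] step_integral_measurable[OF u(2)] by auto
  have eq: "(indicator {a<..<b} s *\<^sub>R F s) ** transpose (indicator {c<..<d} s *\<^sub>R G s)
      = indicator ({a<..<b} \<inter> {c<..<d}) s *\<^sub>R (F s ** transpose (G s))" for s
    by (simp only: indicator_inter_arith bounded_bilinear.scaleR_left[OF bounded_bilinear_mult_transpose]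
        bounded_bilinear.scaleR_right[OF bounded_bilinear_mult_transpose] scaleR_scaleR mult.commute)
  show "integrable M (\<lambda>\<omega>. outer_prod (I \<omega>) (J \<omega>))"
    by (rule bilinear_integrable[OF bounded_bilinear_outer_prod]) (use t u in auto)
  have "integrable lborel (\<lambda>s. (indicator {a<..<b} s *\<^sub>R F s) ** transpose (indicator {c<..<d} s *\<^sub>R G s))"
    by (rule bilinear_integrable[OF bounded_bilinear_mult_transpose]) (use t u in auto)
  then show "set_integrable lborel ({a<..<b} \<inter> {c<..<d}) (\<lambda>s. F s ** transpose (G s))"
    unfolding eq set_integrable_def .
  have step: "(LINT \<omega>|M. outer_prod (step_integral B (\<tau> k) (C k) (n k) \<omega>) (step_integral B (\<sigma> k) (D k) (m k) \<omega>))
     = (LINT s|lborel. step_integrand (\<tau> k) (C k) (n k) s ** transpose (step_integrand (\<sigma> k) (D k) (m k) s))" for k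
    using step_covariance[OF t(1,2) u(1,2), of k "C k" "n k" k "D k" "m k"]
    by (auto simp: has_bochner_integral_iff)
  have "(\<lambda>k. LINT \<omega>|M. outer_prod (step_integral B (\<tau> k) (C k) (n k) \<omega>) (step_integral B (\<sigma> k) (D k) (m k) \<omega>))
     \<longlonglongrightarrow> (LINT \<omega>|M. outer_prod (I \<omega>) (J \<omega>))"
    by (rule bilinear_integral_tendsto[OF bounded_bilinear_outer_prod, where f = I and g = J
          and f' = "\<lambda>k. step_integral B (\<tau> k) (C k) (n k)" and g' = "\<lambda>k. step_integral B (\<sigma> k) (D k) (m k)"])
      (use t u in simp_all)
  moreover have "(\<lambda>k. LINT \<omega>|M. outer_prod (step_integral B (\<tau> k) (C k) (n k) \<omega>) (step_integral B (\<sigma> k) (D k) (m k) \<omega>))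
     \<longlonglongrightarrow> (LINT s|lborel. (indicator {a<..<b} s *\<^sub>R F s) ** transpose (indicator {c<..<d} s *\<^sub>R G s))"
    unfolding step
    by (rule bilinear_integral_tendsto[OF bounded_bilinear_mult_transpose,
          where f = "\<lambda>s. indicator {a<..<b} s *\<^sub>R F s" and g = "\<lambda>s. indicator {c<..<d} s *\<^sub>R G s"
          and f' = "\<lambda>k. step_integrand (\<tau> k) (C k) (n k)" and g' = "\<lambda>k. step_integrand (\<sigma> k) (D k) (m k)"])
      (use t(3,5,7) u(3,5,7) in measurable)
  ultimately show "(LINT \<omega>|M. outer_prod (I \<omega>) (J \<omega>))
      = (LINT s:{a<..<b} \<inter> {c<..<d}|lborel. F s ** transpose (G s))"
    unfolding eq set_lebesgue_integral_def by (rule LIMSEQ_unique)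
qed

end

section \<open>Existence of Wiener integrals of continuous integrands\<close>

lemma step_integrand_at:
  assumes "mono \<tau>" "i < n" "s \<in> {\<tau> i<..\<tau> (Suc i)}"
  shows "step_integrand \<tau> C n s = C i"
proof -
  have "s \<notin> {\<tau> j<..\<tau> (Suc j)}" if "j \<noteq> i" for j
  proof (cases "j < i")
    case True
    then have "\<tau> (Suc j) \<le> \<tau> i" using assms(1) by (simp add: monoD)
    then show ?thesis using assms(3) by auto
  next
    case False
    then have "\<tau> (Suc i) \<le> \<tau> j" using assms(1) that by (simp add: monoD)
    then show ?thesis using assms(3) by auto
  qed
  then have "step_integrand \<tau> C n s = (\<Sum>j<n. if j = i then C i else 0)"
    unfolding step_integrand_def using assms(3) by (intro sum.cong refl) auto
  then show ?thesis using assms(2) by simp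
qed

lemma step_approximation_compact:
  fixes F :: "real \<Rightarrow> real^'n^'m"
  assumes F: "continuous_on {p..q} F" and "p < q" "0 < e"
  obtains \<tau> C n where "mono \<tau>" "range \<tau> \<subseteq> {p..q}"
    "\<And>s. s \<in> {p<..q} \<Longrightarrow> norm (F s - step_integrand \<tau> C n s) \<le> e"
proof -
  have "uniformly_continuous_on {p..q} F"
    by (rule compact_uniformly_continuous[OF F]) simp
  then obtain \<delta> where \<delta>: "\<delta> > 0" "\<And>x y. \<lbrakk>x \<in> {p..q}; y \<in> {p..q}; dist y x < \<delta>\<rbrakk> \<Longrightarrow> dist (F y) (F x) < e"
    using \<open>0 < e\<close> unfolding uniformly_continuous_on_def by metis
  obtain N where N: "(q - p) / \<delta> < real N" using reals_Archimedean2 by blast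
  have "0 < (q - p) / \<delta>" using \<open>p < q\<close> \<delta>(1) by simp
  then have N0: "0 < N" using N by (cases N) auto
  define h where "h = (q - p) / N"
  have h: "0 < h" "h < \<delta>" "real N * h = q - p"
    using N N0 \<open>p < q\<close> \<delta>(1) by (auto simp: h_def field_simps)
  \<comment> \<open>a grid with \<open>N\<close> cells, continued by the constant \<open>q\<close> beyond its last point\<close>
  define \<tau> where "\<tau> i = p + real (min i N) * h" for i
  have le: "real (min i N) * h \<le> q - p" for i
    unfolding h(3)[symmetric] using h(1) by (intro mult_right_mono) auto
  have \<tau>: "mono \<tau>" "range \<tau> \<subseteq> {p..q}"
    using h(1) le unfolding \<tau>_def by (auto intro!: monoI mult_right_mono simp: algebra_simps)
  have "norm (F s - step_integrand \<tau> (\<lambda>i. F (\<tau> (Suc i))) N s) \<le> e" if s: "s \<in> {p<..q}" for s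
  proof -
    \<comment> \<open>\<open>s\<close> lies in the cell that ends at the first grid point not to the left of \<open>s\<close>\<close>
    define k where "k = (LEAST k. s \<le> \<tau> k)"
    have sN: "s \<le> \<tau> N" using s h(3) by (simp add: \<tau>_def)
    have k: "s \<le> \<tau> k" "k \<le> N"
      unfolding k_def using sN by (auto intro: LeastI Least_le)
    have "\<tau> 0 = p" by (simp add: \<tau>_def)
    then have "k \<noteq> 0" using k(1) s by (intro notI) simp
    then obtain i where i: "k = Suc i" using not0_implies_Suc by blast
    have lt: "\<tau> i < s" using not_less_Least[of i "\<lambda>k. s \<le> \<tau> k"] i unfolding k_def by simp
    have "step_integrand \<tau> (\<lambda>i. F (\<tau> (Suc i))) N s = F (\<tau> (Suc i))"
      using k i lt by (intro step_integrand_at \<tau>) auto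
    moreover have "dist (F s) (F (\<tau> (Suc i))) < e"
    proof (rule \<delta>(2))
      show "\<tau> (Suc i) \<in> {p..q}" using \<tau>(2) by blast
      have "\<tau> (Suc i) - \<tau> i = h" using k(2) i by (simp add: \<tau>_def algebra_simps)
      then show "dist s (\<tau> (Suc i)) < \<delta>" using lt k(1) i h(2) by (simp add: dist_real_def)
    qed (use s in auto)
    ultimately show ?thesis by (simp add: dist_norm)
  qed
  then show thesis using that[OF \<tau>] by blast
qed

text \<open>
  The integrand may blow up at the ends of \<open>{a<..<b}\<close> (matrix powers do, at \<open>a = 0\<close>), so uniform approximation is
  available on compact subintervals only. The approximants are set to zero outside subintervals
  exhausting \<open>{a<..<b}\<close>; their squared errors are then dominated by \<open>(norm F)\<^sup>2 + 1\<close> on \<open>{a<..<b}\<close>,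
  and dominated convergence applies.
\<close>

lemma step_approximation:
  fixes F :: "real \<Rightarrow> real^'n^'m"
  assumes "a < b" and cont: "continuous_on {a<..<b} F" and F: "square_integrable_on F {a<..<b}" and "0 < e"
  shows "\<exists>\<tau> C n. mono \<tau> \<and> range \<tau> \<subseteq> {a..b} \<and>
    (\<integral>\<^sup>+ s. ennreal ((norm (indicator {a<..<b} s *\<^sub>R F s - step_integrand \<tau> C n s))\<^sup>2) \<partial>lborel) < ennreal e"
proof -
  \<comment> \<open>3 ensures that the interval from \<open>a + r k\<close> to \<open>b - r k\<close> is nondegenerate already for \<open>k = 0\<close>\<close>
  define r where "r k = (b - a) / (real k + 3)" for k
  have r: "0 < r k" "a + r k < b - r k" for k
  proof -
    show r0: "0 < r k" using \<open>a < b\<close> by (simp add: r_def)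
    have "3 * r k \<le> (real k + 3) * r k" using r0 by (intro mult_right_mono) auto
    also have "\<dots> = b - a" by (simp add: r_def)
    finally show "a + r k < b - r k" using r0 by simp
  qed
  have "\<exists>\<tau> C n. mono \<tau> \<and> range \<tau> \<subseteq> {a + r k..b - r k} \<and>
      (\<forall>s\<in>{a + r k<..b - r k}. norm (F s - step_integrand \<tau> C n s) \<le> 1 / (real k + 1))" for k
  proof -
    have "continuous_on {a + r k..b - r k} F"
      by (rule continuous_on_subset[OF cont]) (use r(1)[of k] in auto)
    then show ?thesis
      using step_approximation_compact[OF _ r(2)[of k], of F "1 / (real k + 1)"] by (metis zero_less_divide_1_iff of_nat_0_le_iff add_nonneg_pos zero_less_one)
  qed
  then obtain \<tau> C n where S: "\<And>k. mono (\<tau> k)" "\<And>k. range (\<tau> k) \<subseteq> {a + r k..b - r k}"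
      "\<And>k s. s\<in>{a + r k<..b - r k} \<Longrightarrow> norm (F s - step_integrand (\<tau> k) (C k) (n k) s) \<le> 1 / (real k + 1)"
    by metis
  let ?S = "\<lambda>k. step_integrand (\<tau> k) (C k) (n k)"
  let ?F = "\<lambda>s. indicator {a<..<b} s *\<^sub>R F s"
  have [measurable]: "?F \<in> borel_measurable lborel"
    using F by (auto simp: square_integrable_on_def set_borel_measurable_def)
  have "set_integrable lborel {a<..<b} (\<lambda>s. (norm (F s))\<^sup>2)"
    using F by (simp add: square_integrable_on_def)
  then have Fi: "integrable lborel (\<lambda>s. (norm (?F s))\<^sup>2)"
    unfolding set_integrable_def
    by (rule Bochner_Integration.integrable_cong[THEN iffD1, rotated -1]) (auto simp: indicator_def)
  have out: "?S k s = 0" if "s \<notin> {a + r k<..b - r k}" for k s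
    using step_integrand_outside[OF S(2) that] .
  have inside: "s \<in> {a<..<b}" if "s \<in> {a + r k<..b - r k}" for k s
    using that r(1)[of k] by auto
  have conv: "(\<lambda>k. (norm (?F s - ?S k s))\<^sup>2) \<longlonglongrightarrow> 0" for s
  proof (cases "s \<in> {a<..<b}")
    case False
    then have "?S k s = 0" for k using out inside by blast
    then show ?thesis using False by simp
  next
    case True
    have "r \<longlonglongrightarrow> 0" unfolding r_def
      by (real_asymp)
    then have "\<forall>\<^sub>F k in sequentially. r k < min (s - a) (b - s)"
      by (rule order_tendstoD) (use True in auto)
    then have "\<forall>\<^sub>F k in sequentially. norm (?F s - ?S k s) \<le> 1 / (real k + 1)"
      by eventually_elim (use True S(3) in auto)
    then have "(\<lambda>k. ?F s - ?S k s) \<longlonglongrightarrow> 0"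
      by (rule Lim_null_comparison) real_asymp
    then have "(\<lambda>k. (norm (?F s - ?S k s))\<^sup>2) \<longlonglongrightarrow> (norm (0::real^'n^'m))\<^sup>2"
      by (intro tendsto_intros)
    then show ?thesis by simp
  qed
  have bound: "norm ((norm (?F s - ?S k s))\<^sup>2) \<le> (norm (?F s))\<^sup>2 + indicator {a<..<b} s" for k s
  proof (cases "s \<in> {a + r k<..b - r k}")
    case True
    then have "norm (?F s - ?S k s) \<le> 1 / (real k + 1)" using S(3) inside by simp
    also have "\<dots> \<le> 1" by simp
    finally show ?thesis using inside[OF True] by (simp add: power_le_one add_increasing)
  next
    case False
    then show ?thesis using out by simp
  qed
  have "(\<lambda>k. LINT s|lborel. (norm (?F s - ?S k s))\<^sup>2) \<longlonglongrightarrow> (LINT s::real|lborel. (0::real))"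
  proof (rule integral_dominated_convergence[where f = "\<lambda>_. 0"
        and s = "\<lambda>k s. (norm (?F s - ?S k s))\<^sup>2" and w = "\<lambda>s. (norm (?F s))\<^sup>2 + indicator {a<..<b} s"])
    show "integrable lborel (\<lambda>s. (norm (?F s))\<^sup>2 + indicator {a<..<b} s)"
      using Fi \<open>a < b\<close> by (intro Bochner_Integration.integrable_add integrable_real_indicator) auto
  qed (use conv bound in auto)
  then have "\<forall>\<^sub>F k in sequentially. (LINT s|lborel. (norm (?F s - ?S k s))\<^sup>2) < e"
    by (rule order_tendstoD) (use \<open>0 < e\<close> in simp)
  then obtain k where k: "(LINT s|lborel. (norm (?F s - ?S k s))\<^sup>2) < e"
    using eventually_sequentially by auto
  have "integrable lborel (\<lambda>s. (norm (?F s))\<^sup>2 + indicator {a<..<b} s)"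
    using Fi \<open>a < b\<close> by (intro Bochner_Integration.integrable_add integrable_real_indicator) auto
  then have "integrable lborel (\<lambda>s. (norm (?F s - ?S k s))\<^sup>2)"
    by (rule Bochner_Integration.integrable_bound) (use bound in auto)
  then have "(\<integral>\<^sup>+ s. ennreal ((norm (?F s - ?S k s))\<^sup>2) \<partial>lborel) < ennreal e"
    using k \<open>0 < e\<close> by (simp add: nn_integral_eq_integral ennreal_less_iff)
  moreover have "range (\<tau> k) \<subseteq> {a..b}" by (rule order_trans[OF S(2)]) (use r(1)[of k] in auto)
  ultimately show ?thesis using S(1) by blast
qed

text \<open>
  The step isometry turns a fast converging sequence of step integrands into a Cauchy sequence of
  elementary integrals, whose mean-square limit is the Wiener integral.
\<close>

theorem (in standard_brownian_motion) has_wiener_integral_exists: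
  fixes F :: "real \<Rightarrow> real^'n^'m"
  assumes "0 \<le> a" "a < b" and cont: "continuous_on {a<..<b} F" and F: "square_integrable_on F {a<..<b}"
  shows "\<exists>I. has_wiener_integral M B a b F I"
proof -
  let ?F = "\<lambda>s. indicator {a<..<b} s *\<^sub>R F s"
  define P where "P k \<tau> C n \<longleftrightarrow> mono \<tau> \<and> range \<tau> \<subseteq> {a..b} \<and>
    (\<integral>\<^sup>+ s. ennreal ((norm (?F s - step_integrand \<tau> C n s))\<^sup>2) \<partial>lborel) < ennreal (1 / 4 ^ k)"
    for k \<tau> C n
  have "\<exists>\<tau> C n. P k \<tau> C n" for k
    unfolding P_def by (rule step_approximation) (use assms in auto)
  then obtain \<tau> C n where "\<And>k. P k (\<tau> k) (C k) (n k)"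
    by metis
  then have S: "\<And>k. mono (\<tau> k)" "\<And>k. range (\<tau> k) \<subseteq> {a..b}"
      "\<And>k. (\<integral>\<^sup>+ s. ennreal ((norm (?F s - step_integrand (\<tau> k) (C k) (n k) s))\<^sup>2) \<partial>lborel) < ennreal (1 / 4 ^ k)"
    unfolding P_def by auto
  let ?S = "\<lambda>k. step_integrand (\<tau> k) (C k) (n k)"
  let ?I = "\<lambda>k. step_integral B (\<tau> k) (C k) (n k)"
  have \<tau>0: "range (\<tau> k) \<subseteq> {0..}" for k by (rule order_trans[OF S(2)]) (use \<open>0 \<le> a\<close> in auto)
  have [measurable]: "?I k \<in> borel_measurable M" for k
    by (rule step_integral_measurable[OF \<tau>0])
  have [measurable]: "?F \<in> borel_measurable lborel"
    using F by (auto simp: square_integrable_on_def set_borel_measurable_def)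
  \<comment> \<open>each squared error is at most \<open>1 / 4 ^ k\<close>, and passing through \<open>F\<close> costs a factor 2 for each of the two errors\<close>
  have cauchy: "(\<integral>\<^sup>+\<omega>. ennreal ((norm (?I j \<omega> - ?I k \<omega>))\<^sup>2) \<partial>M) \<le> ennreal (4 / 4 ^ k)" if "k \<le> j" for j k
  proof -
    have "(\<integral>\<^sup>+\<omega>. ennreal ((norm (?I j \<omega> - ?I k \<omega>))\<^sup>2) \<partial>M)
        = (\<integral>\<^sup>+s. ennreal ((norm (?S j s - ?S k s))\<^sup>2) \<partial>lborel)"
      by (intro step_isometry S \<tau>0)
    also have "\<dots> \<le> (\<integral>\<^sup>+s. 2 * ennreal ((norm (?F s - ?S j s))\<^sup>2) + 2 * ennreal ((norm (?F s - ?S k s))\<^sup>2) \<partial>lborel)"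
    proof (rule nn_integral_mono)
      fix s
      have "(norm (?S j s - ?S k s))\<^sup>2 \<le> (norm (?F s - ?S k s) + norm (?F s - ?S j s))\<^sup>2"
        using norm_triangle_ineq4[of "?F s - ?S k s" "?F s - ?S j s"] by (intro power_mono) auto
      also have "\<dots> \<le> 2 * (norm (?F s - ?S j s))\<^sup>2 + 2 * (norm (?F s - ?S k s))\<^sup>2"
        using sum_squares_bound[of "norm (?F s - ?S k s)" "norm (?F s - ?S j s)"] by (simp add: power2_sum)
      finally show "ennreal ((norm (?S j s - ?S k s))\<^sup>2)
          \<le> 2 * ennreal ((norm (?F s - ?S j s))\<^sup>2) + 2 * ennreal ((norm (?F s - ?S k s))\<^sup>2)"
        by (subst (1 2) ennreal_numeral[symmetric])
           (simp add: ennreal_leI flip: ennreal_mult ennreal_plus del: ennreal_numeral)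
    qed
    also have "\<dots> = 2 * (\<integral>\<^sup>+s. ennreal ((norm (?F s - ?S j s))\<^sup>2) \<partial>lborel)
        + 2 * (\<integral>\<^sup>+s. ennreal ((norm (?F s - ?S k s))\<^sup>2) \<partial>lborel)"
      by (simp add: nn_integral_add nn_integral_cmult)
    also have "\<dots> \<le> 2 * ennreal (1 / 4 ^ j) + 2 * ennreal (1 / 4 ^ k)"
      by (intro add_mono mult_left_mono less_imp_le S(3)) auto
    also have "\<dots> \<le> 2 * ennreal (1 / 4 ^ k) + 2 * ennreal (1 / 4 ^ k)"
      using that by (intro add_mono mult_left_mono ennreal_leI order_refl divide_left_mono power_increasing) auto
    also have "\<dots> = ennreal (4 / 4 ^ k)"
      by (subst (1 2) ennreal_numeral[symmetric])
         (simp flip: ennreal_mult ennreal_plus del: ennreal_numeral)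
    finally show ?thesis .
  qed
  obtain I where I: "I \<in> borel_measurable M" "(\<lambda>k. \<integral>\<^sup>+\<omega>. ennreal ((norm (I \<omega> - ?I k \<omega>))\<^sup>2) \<partial>M) \<longlonglongrightarrow> 0"
    by (rule mean_square_limit_exists[of ?I M 4]) (use cauchy finite_measure_axioms in auto)
  have "(\<lambda>k. \<integral>\<^sup>+ s. ennreal ((norm (?F s - ?S k s))\<^sup>2) \<partial>lborel) \<longlonglongrightarrow> 0"
  proof (rule tendsto_sandwich[OF always_eventually always_eventually tendsto_const])
    have "(\<lambda>k. 1 / 4 ^ k :: real) \<longlonglongrightarrow> 0" by real_asymp
    then show "(\<lambda>k. ennreal (1 / 4 ^ k)) \<longlonglongrightarrow> 0"
      using tendsto_ennrealI by fastforce
  qed (use S(3) in \<open>auto intro: less_imp_le\<close>)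
  then have "has_wiener_integral M B a b F I"
    unfolding has_wiener_integral_def nn_integral_Ioo_step[OF S(2), symmetric]
    using F I S(1,2) by blast
  then show ?thesis by blast
qed

section \<open>Real powers of matrices whose square is scalar\<close>

text \<open>
  When \<open>A ** A = c *\<^sub>R mat 1\<close>, the even and odd parts of the exponential series of \<open>x *\<^sub>R A\<close> are
  multiples of the identity and of \<open>A\<close>. The coefficients are \<open>cosh (x * sqrt c)\<close> and
  \<open>sinh (x * sqrt c) / sqrt c\<close>; the complex square root covers the trigonometric case \<open>c < 0\<close> as
  well, and the odd coefficient is continued to \<open>c = 0\<close> by its limit \<open>x\<close>.
\<close>

definition cosh_sqrt :: "real \<Rightarrow> real \<Rightarrow> real" where
  "cosh_sqrt c x = Re (cosh (csqrt c * x))"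

definition sinhc_sqrt :: "real \<Rightarrow> real \<Rightarrow> real" where
  "sinhc_sqrt c x = (if c = 0 then x else Re (sinh (csqrt c * x) / csqrt c))"

lemma csqrt_mult_self: "csqrt (of_real c) * csqrt (of_real c) = of_real c"
  using power2_csqrt[of "of_real c"] by (simp add: power2_eq_square)

lemma cosh_sqrt_sums:
  "(\<lambda>k. if even k then c ^ (k div 2) * x ^ k / fact k else 0) sums cosh_sqrt c x"
proof -
  have eq: "Re (if even k then (csqrt c * x) ^ k /\<^sub>R fact k else 0)
      = (if even k then c ^ (k div 2) * x ^ k / fact k else 0)" for k
  proof (cases "even k")
    case True
    then obtain m where m: "k = 2 * m" by blast
    have "(csqrt c * x) ^ k = of_real (c ^ m * x ^ k)"
      unfolding m power_mult_distrib power_mult by simp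
    then show ?thesis using m by (simp add: divide_inverse)
  qed simp
  show ?thesis
    using sums_Re[OF cosh_converges[of "csqrt c * x"]] unfolding eq cosh_sqrt_def .
qed

lemma sinhc_sqrt_sums:
  "(\<lambda>k. if even k then 0 else c ^ (k div 2) * x ^ k / fact k) sums sinhc_sqrt c x"
proof (cases "c = 0")
  case True
  have "(\<lambda>k. if even k then 0 else c ^ (k div 2) * x ^ k / fact k) sums
      (\<Sum>k\<in>{1}. if even k then 0 else c ^ (k div 2) * x ^ k / fact k)"
    by (rule sums_finite) (use True in \<open>auto elim!: oddE simp: power_0_left\<close>)
  then show ?thesis using True by (simp add: sinhc_sqrt_def)
next
  case False
  then have w: "csqrt c \<noteq> 0" by simp
  have eq: "Re ((if even k then 0 else (csqrt c * x) ^ k /\<^sub>R fact k) / csqrt c)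
      = (if even k then 0 else c ^ (k div 2) * x ^ k / fact k)" for k
  proof (cases "even k")
    case False
    then obtain m where m: "k = 2 * m + 1" by (rule oddE)
    have "(csqrt c * x) ^ k = of_real (c ^ m * x ^ k) * csqrt c"
      unfolding m power_mult_distrib power_add power_mult by simp
    then have "(csqrt c * x) ^ k / csqrt c = of_real (c ^ m * x ^ k)"
      using w by simp
    then have "((csqrt c * x) ^ k /\<^sub>R fact k) / csqrt c = of_real (c ^ m * x ^ k / fact k)"
      by (simp add: scaleR_conv_of_real divide_inverse mult_ac)
    then have "Re (((csqrt c * x) ^ k /\<^sub>R fact k) / csqrt c) = c ^ m * x ^ k / fact k"
      by (metis Re_complex_of_real)
    then show ?thesis using m by simp
  qed simp
  show ?thesis
    using sums_Re[OF sums_divide[OF sinh_converges[of "csqrt c * x"], of "csqrt c"]] False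
    unfolding eq sinhc_sqrt_def by simp
qed

lemma DERIV_Re_of_real:
  fixes f :: "complex \<Rightarrow> complex"
  assumes "(f has_field_derivative D) (at (of_real x))"
  shows "((\<lambda>x. Re (f (of_real x))) has_real_derivative Re D) (at x)"
  using bounded_linear.has_vector_derivative[OF bounded_linear_Re has_vector_derivative_real_field[OF assms]]
  by (simp add: has_real_derivative_iff_has_vector_derivative)

lemma DERIV_cosh_sqrt: "(cosh_sqrt c has_real_derivative c * sinhc_sqrt c x) (at x)"
proof -
  have "((\<lambda>z. cosh (csqrt c * z)) has_field_derivative csqrt c * sinh (csqrt c * of_real x)) (at (of_real x))"
    by (auto intro!: derivative_eq_intros)
  from DERIV_Re_of_real[OF this]
  have d: "(cosh_sqrt c has_real_derivative Re (csqrt c * sinh (csqrt c * of_real x))) (at x)"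
    unfolding cosh_sqrt_def[abs_def] .
  have eq: "csqrt c * y = of_real c * (y / csqrt c)" for y
  proof (cases "c = 0")
    case False
    then have "csqrt c * csqrt c * (y / csqrt c) = csqrt c * y" by simp
    then show ?thesis unfolding csqrt_mult_self ..
  qed simp
  then have "Re (csqrt c * sinh (csqrt c * of_real x)) = c * sinhc_sqrt c x"
    unfolding eq[of "sinh (csqrt c * of_real x)"] scaleR_conv_of_real[symmetric] scaleR_complex.sel
    by (simp add: sinhc_sqrt_def)
  with d show ?thesis by simp
qed

lemma DERIV_sinhc_sqrt: "(sinhc_sqrt c has_real_derivative cosh_sqrt c x) (at x)"
proof (cases "c = 0")
  case True
  then show ?thesis by (auto simp: sinhc_sqrt_def[abs_def] cosh_sqrt_def intro!: derivative_eq_intros)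
next
  case False
  have "((\<lambda>z. sinh (csqrt c * z) / csqrt c) has_field_derivative cosh (csqrt c * of_real x)) (at (of_real x))"
    using False by (auto intro!: derivative_eq_intros)
  from DERIV_Re_of_real[OF this] show ?thesis
    using False unfolding sinhc_sqrt_def[abs_def] cosh_sqrt_def by simp
qed

lemma norm_cosh_sinh_le:
  fixes z :: complex
  shows "norm (cosh z) \<le> exp \<bar>Re z\<bar>" "norm (sinh z) \<le> exp \<bar>Re z\<bar>"
proof -
  have e: "norm (exp z) \<le> exp \<bar>Re z\<bar>" "norm (exp (-z)) \<le> exp \<bar>Re z\<bar>" by auto
  have half: "norm (w /\<^sub>R 2) \<le> r" if "norm w \<le> r + r" for w :: complex and r using that by simp
  show "norm (cosh z) \<le> exp \<bar>Re z\<bar>"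
    unfolding cosh_def by (intro half norm_triangle_le add_mono e)
  show "norm (sinh z) \<le> exp \<bar>Re z\<bar>"
    unfolding sinh_def by (intro half norm_triangle_le_diff add_mono e)
qed

lemma Re_csqrt_less_half:
  assumes "c < 1/4"
  shows "0 \<le> Re (csqrt (of_real c))" "Re (csqrt (of_real c)) < 1/2"
proof -
  show "0 \<le> Re (csqrt (of_real c))" by (rule Re_csqrt)
  show "Re (csqrt (of_real c)) < 1/2"
  proof (cases "c \<ge> 0")
    case True
    have "sqrt c < sqrt ((1/2)\<^sup>2)" using assms by (simp only: real_sqrt_less_iff) (simp add: power2_eq_square)
    then show ?thesis using True by simp
  next
    case False
    then show ?thesis by simp
  qed
qed

text \<open>
  This is where \<open>c < 1/4\<close> enters: the coefficients grow at most like \<open>exp (x * Re (csqrt c))\<close>, up to a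
  factor \<open>x\<close> when \<open>c = 0\<close>, and \<open>Re (csqrt c) < 1/2\<close>.
\<close>

lemma cosh_sinhc_sqrt_decay:
  assumes "c < 1/4"
  shows "((\<lambda>x. exp (- x / 2) * cosh_sqrt c x) \<longlongrightarrow> 0) at_top"
    and "((\<lambda>x. exp (- x / 2) * sinhc_sqrt c x) \<longlongrightarrow> 0) at_top"
proof -
  define \<delta> where "\<delta> = 1/2 - Re (csqrt c)"
  have \<delta>: "0 < \<delta>" using Re_csqrt_less_half[OF assms] by (simp add: \<delta>_def)
  have exp_bound: "exp (- x / 2) * exp \<bar>Re (csqrt c * x)\<bar> = exp (- (\<delta> * x))" if "0 \<le> x" for x
  proof -
    have "\<bar>Re (csqrt c * x)\<bar> = Re (csqrt c) * x"
      using that Re_csqrt_less_half(1)[OF assms] by (simp add: abs_mult)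
    then show ?thesis by (simp add: \<delta>_def algebra_simps flip: exp_add)
  qed
  have lim: "((\<lambda>x. exp (- (\<delta> * x))) \<longlongrightarrow> 0) at_top" using \<delta> by real_asymp
  show "((\<lambda>x. exp (- x / 2) * cosh_sqrt c x) \<longlongrightarrow> 0) at_top"
  proof (rule Lim_null_comparison[OF eventually_mono[OF eventually_ge_at_top[of 0]] lim])
    fix x :: real assume x: "0 \<le> x"
    have "\<bar>cosh_sqrt c x\<bar> \<le> exp \<bar>Re (csqrt c * x)\<bar>"
      unfolding cosh_sqrt_def using abs_Re_le_cmod norm_cosh_sinh_le(1) order_trans by blast
    then have "exp (- x / 2) * \<bar>cosh_sqrt c x\<bar> \<le> exp (- x / 2) * exp \<bar>Re (csqrt c * x)\<bar>"
      by (intro mult_left_mono) auto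
    then show "norm (exp (- x / 2) * cosh_sqrt c x) \<le> exp (- (\<delta> * x))"
      unfolding exp_bound[OF x] by (simp add: abs_mult)
  qed
  show "((\<lambda>x. exp (- x / 2) * sinhc_sqrt c x) \<longlongrightarrow> 0) at_top"
  proof (cases "c = 0")
    case True
    have "((\<lambda>x::real. exp (- x / 2) * x) \<longlongrightarrow> 0) at_top" by real_asymp
    then show ?thesis using True by (simp add: sinhc_sqrt_def)
  next
    case False
    have lim': "((\<lambda>x. exp (- (\<delta> * x)) / norm (csqrt c)) \<longlongrightarrow> 0) at_top"
      using tendsto_divide[OF lim tendsto_const, of "norm (csqrt c)"] False by simp
    show ?thesis
    proof (rule Lim_null_comparison[OF eventually_mono[OF eventually_ge_at_top[of 0]] lim'])
      fix x :: real assume x: "0 \<le> x"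
      have "\<bar>sinhc_sqrt c x\<bar> \<le> norm (sinh (csqrt c * x) / csqrt c)"
        using False abs_Re_le_cmod unfolding sinhc_sqrt_def by (simp only: if_False)
      also have "\<dots> \<le> exp \<bar>Re (csqrt c * x)\<bar> / norm (csqrt c)"
        unfolding norm_divide by (intro divide_right_mono norm_cosh_sinh_le) auto
      finally have "exp (- x / 2) * \<bar>sinhc_sqrt c x\<bar>
          \<le> exp (- x / 2) * (exp \<bar>Re (csqrt c * x)\<bar> / norm (csqrt c))"
        by (intro mult_left_mono) auto
      then show "norm (exp (- x / 2) * sinhc_sqrt c x) \<le> exp (- (\<delta> * x)) / norm (csqrt c)"
        unfolding times_divide_eq_right exp_bound[OF x] by (simp add: abs_mult)
    qed
  qed
qed

lemma matrix_exp_square_scalar: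
  fixes A :: "real^'n^'n"
  assumes A: "A ** A = c *\<^sub>R mat 1"
  shows "matrix_exp (x *\<^sub>R A) = cosh_sqrt c x *\<^sub>R mat 1 + sinhc_sqrt c x *\<^sub>R A"
proof -
  interpret mm: bounded_bilinear "(**) :: real^'n^'n \<Rightarrow> real^'n^'n \<Rightarrow> real^'n^'n"
    by (rule bounded_bilinear_matrix_mult)
  have pow: "((**) (x *\<^sub>R A) ^^ k) (mat 1)
      = (x ^ k * c ^ (k div 2)) *\<^sub>R (if even k then mat 1 else A)" for k
  proof (induction k)
    case (Suc k)
    then show ?case
      by (auto simp: mm.scaleR_left mm.scaleR_right A elim!: evenE oddE)
  qed simp
  have "(1 / fact k) *\<^sub>R ((**) (x *\<^sub>R A) ^^ k) (mat 1)
      = (if even k then c ^ (k div 2) * x ^ k / fact k else 0) *\<^sub>R mat 1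
      + (if even k then 0 else c ^ (k div 2) * x ^ k / fact k) *\<^sub>R A" for k
    unfolding pow by (auto simp: mult.commute)
  moreover have "(\<lambda>k. (if even k then c ^ (k div 2) * x ^ k / fact k else 0) *\<^sub>R mat 1
      + (if even k then 0 else c ^ (k div 2) * x ^ k / fact k) *\<^sub>R A)
      sums (cosh_sqrt c x *\<^sub>R mat 1 + sinhc_sqrt c x *\<^sub>R A)"
    by (intro sums_add sums_scaleR_left cosh_sqrt_sums sinhc_sqrt_sums)
  ultimately show ?thesis
    unfolding matrix_exp_def by (simp add: sums_iff)
qed

lemma rpow_matrix_square_scalar:
  fixes A :: "real^'n^'n"
  assumes A: "A ** A = c *\<^sub>R mat 1"
  shows "rpow_matrix x A = cosh_sqrt c (ln x) *\<^sub>R mat 1 + sinhc_sqrt c (ln x) *\<^sub>R A"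
  unfolding rpow_matrix_def by (rule matrix_exp_square_scalar[OF A])

lemma rpow_matrix_1:
  fixes A :: "real^'n^'n"
  assumes A: "A ** A = c *\<^sub>R mat 1"
  shows "rpow_matrix 1 A = mat 1"
  by (simp add: rpow_matrix_square_scalar[OF A] cosh_sqrt_def sinhc_sqrt_def)

lemma rpow_matrix_transpose:
  fixes A :: "real^'n^'n"
  assumes A: "A ** A = c *\<^sub>R mat 1"
  shows "rpow_matrix x (transpose A) = transpose (rpow_matrix x A)"
proof -
  have "transpose A ** transpose A = c *\<^sub>R mat 1"
    by (simp add: matrix_transpose_mul[symmetric] A transpose_scalar)
  from rpow_matrix_square_scalar[OF this] show ?thesis
    by (simp add: rpow_matrix_square_scalar[OF A] linear_add[OF bounded_linear.linear[OF bounded_linear_transpose]] transpose_scalar)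
qed

lemma rpow_matrix_commute:
  fixes A :: "real^'n^'n"
  assumes A: "A ** A = c *\<^sub>R mat 1"
  shows "rpow_matrix x A ** A = A ** rpow_matrix x A"
  by (simp add: rpow_matrix_square_scalar[OF A] bounded_bilinear.add_left[OF bounded_bilinear_matrix_mult]
      bounded_bilinear.add_right[OF bounded_bilinear_matrix_mult] bounded_bilinear.scaleR_left[OF bounded_bilinear_matrix_mult]
      bounded_bilinear.scaleR_right[OF bounded_bilinear_matrix_mult])

lemma rpow_matrix_has_vector_derivative:
  fixes A :: "real^'n^'n"
  assumes A: "A ** A = c *\<^sub>R mat 1" and "0 < t" "0 < u"
  shows "((\<lambda>u. rpow_matrix (t / u) A) has_vector_derivative
      (- 1 / u) *\<^sub>R (A ** rpow_matrix (t / u) A)) (at u)"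
proof -
  interpret mm: bounded_bilinear "(**) :: real^'n^'n \<Rightarrow> real^'n^'n \<Rightarrow> real^'n^'n"
    by (rule bounded_bilinear_matrix_mult)
  have ln: "((\<lambda>u. ln (t / u)) has_real_derivative - 1 / u) (at u)"
    using assms by (auto intro!: derivative_eq_intros simp: field_simps power2_eq_square)
  have "((\<lambda>u. cosh_sqrt c (ln (t / u)) *\<^sub>R (mat 1 :: real^'n^'n) + sinhc_sqrt c (ln (t / u)) *\<^sub>R A)
      has_vector_derivative
      (c * sinhc_sqrt c (ln (t / u)) * (- 1 / u)) *\<^sub>R mat 1 + (cosh_sqrt c (ln (t / u)) * (- 1 / u)) *\<^sub>R A) (at u)"
    using has_vector_derivative_add[OF
        has_vector_derivative_scaleR[OF DERIV_chain2[OF DERIV_cosh_sqrt ln] has_vector_derivative_const]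
        has_vector_derivative_scaleR[OF DERIV_chain2[OF DERIV_sinhc_sqrt ln] has_vector_derivative_const],
        of c "mat 1" c A]
    by simp
  then show ?thesis
    by (simp add: rpow_matrix_square_scalar[OF A] mm.add_right mm.scaleR_right A algebra_simps)
qed

text \<open>
  The substitution \<open>x = ln (t / u)\<close> turns the exponential decay at infinity into decay at \<open>0\<close>, as
  \<open>exp (- x / 2) = sqrt (u / t)\<close>.
\<close>

lemma rpow_matrix_decay:
  fixes A :: "real^'n^'n"
  assumes A: "A ** A = c *\<^sub>R mat 1" and "c < 1/4" "0 < t"
  shows "((\<lambda>u. sqrt u *\<^sub>R rpow_matrix (t / u) A) \<longlongrightarrow> 0) (at_right 0)"
proof -
  have "((\<lambda>x. (exp (- x / 2) * cosh_sqrt c x) *\<^sub>R (mat 1 :: real^'n^'n) + (exp (- x / 2) * sinhc_sqrt c x) *\<^sub>R A)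
      \<longlongrightarrow> 0 *\<^sub>R mat 1 + 0 *\<^sub>R A) at_top"
    by (intro tendsto_intros cosh_sinhc_sqrt_decay assms)
  moreover have "filterlim (\<lambda>u. ln (t / u)) at_top (at_right 0)"
    using \<open>0 < t\<close> by real_asymp
  ultimately have "((\<lambda>u. (exp (- ln (t / u) / 2) * cosh_sqrt c (ln (t / u))) *\<^sub>R (mat 1 :: real^'n^'n)
      + (exp (- ln (t / u) / 2) * sinhc_sqrt c (ln (t / u))) *\<^sub>R A) \<longlongrightarrow> 0) (at_right 0)"
    using filterlim_compose by fastforce
  then have "((\<lambda>u. exp (- ln (t / u) / 2) *\<^sub>R rpow_matrix (t / u) A) \<longlongrightarrow> 0) (at_right 0)"
    by (simp add: rpow_matrix_square_scalar[OF A] scaleR_add_right)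
  then have "((\<lambda>u. sqrt t *\<^sub>R exp (- ln (t / u) / 2) *\<^sub>R rpow_matrix (t / u) A) \<longlongrightarrow> sqrt t *\<^sub>R 0) (at_right 0)"
    by (intro tendsto_intros)
  moreover have "\<forall>\<^sub>F u in at_right 0. sqrt t *\<^sub>R exp (- ln (t / u) / 2) *\<^sub>R rpow_matrix (t / u) A
      = sqrt u *\<^sub>R rpow_matrix (t / u) A"
  proof (rule eventually_mono[OF eventually_at_right_less])
    fix u :: real assume u: "0 < u"
    have "exp (- ln (t / u) / 2) = exp (ln (u / t) / 2)"
      using u \<open>0 < t\<close> by (simp add: ln_div)
    also have "\<dots> = sqrt (u / t)"
      using u \<open>0 < t\<close> by (simp add: powr_def flip: powr_half_sqrt)
    finally have "sqrt t * exp (- ln (t / u) / 2) = sqrt u"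
      using u \<open>0 < t\<close> by (simp add: real_sqrt_divide)
    then show "sqrt t *\<^sub>R exp (- ln (t / u) / 2) *\<^sub>R rpow_matrix (t / u) A
      = sqrt u *\<^sub>R rpow_matrix (t / u) A"
      by (simp only: scaleR_scaleR)
  qed
  ultimately show ?thesis
    by (simp only: scaleR_zero_right) (rule Lim_transform_eventually)
qed

section \<open>Integrals of products of matrix powers\<close>

text \<open>
  If \<open>S\<close> solves the Lyapunov equation \<open>S = mat 1 + A ** S + S ** transpose A\<close>, then
  \<open>u *\<^sub>R (rpow_matrix (s / u) A ** S ** transpose (rpow_matrix (t / u) A))\<close> is a primitive, in \<open>u\<close>, of
  the product \<open>rpow_matrix (s / u) A ** transpose (rpow_matrix (t / u) A)\<close>. Splitting the factor \<open>u\<close>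
  as \<open>sqrt u * sqrt u\<close>, one half for each power, shows that it vanishes at \<open>0\<close>.
\<close>

lemma tendsto_lyapunov_primitive:
  fixes A S :: "real^'n^'n"
  assumes A: "A ** A = c *\<^sub>R mat 1" and "c < 1/4" "0 < s" "0 < t"
  shows "((\<lambda>u. u *\<^sub>R (rpow_matrix (s / u) A ** S ** transpose (rpow_matrix (t / u) A))) \<longlongrightarrow> 0) (at_right 0)"
proof -
  let ?h = "\<lambda>X Y :: real^'n^'n. X ** S ** transpose Y"
  have h: "bounded_bilinear ?h"
    by (rule bounded_bilinear.comp[OF bounded_bilinear_mult_transpose
          bounded_bilinear.bounded_linear_left[OF bounded_bilinear_matrix_mult] bounded_linear_ident])
  have "((\<lambda>u. ?h (sqrt u *\<^sub>R rpow_matrix (s / u) A) (sqrt u *\<^sub>R rpow_matrix (t / u) A)) \<longlongrightarrow> ?h 0 0) (at_right 0)"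
    by (intro bounded_bilinear.tendsto[OF h] rpow_matrix_decay[OF A] assms)
  then have "((\<lambda>u. ?h (sqrt u *\<^sub>R rpow_matrix (s / u) A) (sqrt u *\<^sub>R rpow_matrix (t / u) A)) \<longlongrightarrow> 0) (at_right 0)"
    by (simp only: bounded_bilinear.zero_left[OF h])
  moreover have "\<forall>\<^sub>F u in at_right 0. ?h (sqrt u *\<^sub>R rpow_matrix (s / u) A) (sqrt u *\<^sub>R rpow_matrix (t / u) A)
      = u *\<^sub>R ?h (rpow_matrix (s / u) A) (rpow_matrix (t / u) A)"
    by (rule eventually_mono[OF eventually_at_right_less])
       (simp add: bounded_bilinear.scaleR_left[OF h] bounded_bilinear.scaleR_right[OF h])
  ultimately show ?thesis by (rule Lim_transform_eventually)
qed

text \<open>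
  Since \<open>A\<close> commutes with its powers, the product rule leaves the factor
  \<open>S - A ** S - S ** transpose A\<close> between the two powers, and this factor is the identity.
\<close>

lemma lyapunov_primitive_has_vector_derivative:
  fixes A S :: "real^'n^'n"
  assumes A: "A ** A = c *\<^sub>R mat 1" and S: "S = mat 1 + A ** S + S ** transpose A"
    and "0 < s" "0 < t" "0 < u"
  shows "((\<lambda>u. u *\<^sub>R (rpow_matrix (s / u) A ** S ** transpose (rpow_matrix (t / u) A)))
    has_vector_derivative rpow_matrix (s / u) A ** transpose (rpow_matrix (t / u) A)) (at u)"
proof -
  interpret mm: bounded_bilinear "(**) :: real^'n^'n \<Rightarrow> real^'n^'n \<Rightarrow> real^'n^'n"
    by (rule bounded_bilinear_matrix_mult)
  let ?h = "\<lambda>X Y :: real^'n^'n. X ** S ** transpose Y"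
  have h: "bounded_bilinear ?h"
    by (rule bounded_bilinear.comp[OF bounded_bilinear_mult_transpose
          bounded_bilinear.bounded_linear_left[OF bounded_bilinear_matrix_mult] bounded_linear_ident])
  let ?X = "rpow_matrix (s / u) A" and ?Y = "rpow_matrix (t / u) A"
  have "((\<lambda>u. u *\<^sub>R ?h (rpow_matrix (s / u) A) (rpow_matrix (t / u) A)) has_vector_derivative
     u *\<^sub>R (?h ?X ((- 1 / u) *\<^sub>R (A ** ?Y)) + ?h ((- 1 / u) *\<^sub>R (A ** ?X)) ?Y) + 1 *\<^sub>R ?h ?X ?Y) (at u)"
    by (intro has_vector_derivative_scaleR DERIV_ident bounded_bilinear.has_vector_derivative[OF h]
        rpow_matrix_has_vector_derivative[OF A] assms)
  moreover have "u *\<^sub>R (?h ?X ((- 1 / u) *\<^sub>R (A ** ?Y)) + ?h ((- 1 / u) *\<^sub>R (A ** ?X)) ?Y) + 1 *\<^sub>R ?h ?X ?Y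
      = ?X ** (S - A ** S - S ** transpose A) ** transpose ?Y"
    unfolding bounded_bilinear.scaleR_left[OF h] bounded_bilinear.scaleR_right[OF h]
    unfolding rpow_matrix_commute[OF A, symmetric] matrix_transpose_mul
    using \<open>0 < u\<close>
    by (simp add: mm.diff_left mm.diff_right matrix_mul_assoc scaleR_add_right scaleR_diff_right)
  moreover have "S - A ** S - S ** transpose A = mat 1"
    using S by (metis add_diff_cancel_right' diff_diff_add add.commute)
  ultimately show ?thesis by simp
qed

lemma continuous_on_rpow_matrix:
  fixes A :: "real^'n^'n"
  assumes A: "A ** A = c *\<^sub>R mat 1" and "0 < t"
  shows "continuous_on {0<..} (\<lambda>u. rpow_matrix (t / u) A)"
proof (rule continuous_at_imp_continuous_on, rule ballI)
  fix u :: real assume "u \<in> {0<..}"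
  then show "isCont (\<lambda>u. rpow_matrix (t / u) A) u"
    using has_vector_derivative_continuous[OF rpow_matrix_has_vector_derivative[OF A \<open>0 < t\<close>, of u]] by simp
qed

lemma isCont_rpow_product:
  fixes A :: "real^'n^'n"
  assumes A: "A ** A = c *\<^sub>R mat 1" and "0 < s" "0 < t" "0 < u"
  shows "isCont (\<lambda>u. rpow_matrix (s / u) A ** transpose (rpow_matrix (t / u) A)) u"
  by (rule bounded_bilinear.continuous[OF bounded_bilinear_mult_transpose
        has_vector_derivative_continuous[OF rpow_matrix_has_vector_derivative[OF A assms(2,4)]]
        has_vector_derivative_continuous[OF rpow_matrix_has_vector_derivative[OF A assms(3,4)]]])

text \<open>
  The squared Frobenius norm of a matrix \<open>X\<close> is the trace of \<open>X ** transpose X\<close>, so here it has a primitive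
  with finite limits at both ends of \<open>{0<..<t}\<close>. A nonnegative function with such a primitive is
  integrable.
\<close>

theorem square_integrable_rpow_matrix:
  fixes A S :: "real^'n^'n"
  assumes A: "A ** A = c *\<^sub>R mat 1" "c < 1/4" and S: "S = mat 1 + A ** S + S ** transpose A"
    and t: "0 < t"
  shows "square_integrable_on (\<lambda>u. rpow_matrix (t / u) A) {0<..<t}"
proof -
  let ?X = "\<lambda>u. rpow_matrix (t / u) A"
  let ?P = "\<lambda>u. u *\<^sub>R (?X u ** S ** transpose (?X u))"
  have d: "((\<lambda>u. trace (?P u)) has_real_derivative (norm (?X u))\<^sup>2) (at u)" if "0 < u" for u
    using bounded_linear.has_vector_derivative[OF bounded_linear_trace
        lyapunov_primitive_has_vector_derivative[OF A(1) S t t that]]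
    by (simp add: has_real_derivative_iff_has_vector_derivative trace_mult_transpose power2_norm_eq_inner)
  have "set_integrable lborel (einterval (ereal 0) (ereal t)) (\<lambda>u. (norm (?X u))\<^sup>2)"
  proof (rule interval_integral_FTC_nonneg(1))
    show "(((\<lambda>u. trace (?P u)) \<circ> real_of_ereal) \<longlongrightarrow> trace (0 :: real^'n^'n)) (at_right (ereal 0))"
      unfolding ereal_tendsto_simps
      by (intro bounded_linear.tendsto[OF bounded_linear_trace] tendsto_lyapunov_primitive[OF A] t)
    show "(((\<lambda>u. trace (?P u)) \<circ> real_of_ereal) \<longlongrightarrow> trace (?P t)) (at_left (ereal t))"
      using DERIV_isCont[OF d[OF t]] unfolding ereal_tendsto_simps isCont_def
      by (rule filterlim_mono[OF _ order_refl at_le]) simp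
    show "isCont (\<lambda>u. (norm (?X u))\<^sup>2) u" if "ereal 0 < ereal u" for u
      using has_vector_derivative_continuous[OF rpow_matrix_has_vector_derivative[OF A(1) t, of u]] that
      by (auto intro!: continuous_intros)
  qed (use t d in auto)
  then have "set_integrable lborel {0<..<t} (\<lambda>u. (norm (?X u))\<^sup>2)" by simp
  moreover have "continuous_on {0<..<t} ?X"
    by (rule continuous_on_subset[OF continuous_on_rpow_matrix[OF A(1) t]]) auto
  then have "set_borel_measurable lborel {0<..<t} ?X"
    by (simp add: set_borel_measurable_def borel_measurable_continuous_on_indicator)
  ultimately show ?thesis by (simp add: square_integrable_on_def)
qed

theorem integral_rpow_matrix_product:
  fixes A S :: "real^'n^'n"
  assumes A: "A ** A = c *\<^sub>R mat 1" "c < 1/4" and S: "S = mat 1 + A ** S + S ** transpose A"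
    and st: "0 < s" "0 < t"
    and int: "set_integrable lborel {0<..<s} (\<lambda>u. rpow_matrix (s / u) A ** transpose (rpow_matrix (t / u) A))"
  shows "(LINT u:{0<..<s}|lborel. rpow_matrix (s / u) A ** transpose (rpow_matrix (t / u) A))
    = s *\<^sub>R (S ** rpow_matrix (t / s) (transpose A))"
proof -
  let ?f = "\<lambda>u. rpow_matrix (s / u) A ** transpose (rpow_matrix (t / u) A)"
  let ?P = "\<lambda>u. u *\<^sub>R (rpow_matrix (s / u) A ** S ** transpose (rpow_matrix (t / u) A))"
  have d: "(?P has_vector_derivative ?f u) (at u)" if "0 < u" for u
    by (rule lyapunov_primitive_has_vector_derivative[OF A(1) S st that])
  have "(LBINT u=ereal 0..ereal s. ?f u) = ?P s - 0"
  proof (rule interval_integral_FTC_integrable)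
    show "((?P \<circ> real_of_ereal) \<longlongrightarrow> 0) (at_right (ereal 0))"
      unfolding ereal_tendsto_simps by (rule tendsto_lyapunov_primitive[OF A st])
    have "isCont ?P s"
      using has_vector_derivative_continuous[OF d[OF st(1)]] .
    then show "((?P \<circ> real_of_ereal) \<longlongrightarrow> ?P s) (at_left (ereal s))"
      unfolding ereal_tendsto_simps isCont_def by (rule filterlim_mono[OF _ order_refl at_le]) simp
  qed (use st d int in \<open>auto intro: isCont_rpow_product[OF A(1)]\<close>)
  also have "\<dots> = s *\<^sub>R (S ** rpow_matrix (t / s) (transpose A))"
    using st by (simp add: rpow_matrix_1[OF A(1)] rpow_matrix_transpose[OF A(1)])
  finally show ?thesis
    using st by (simp add: interval_lebesgue_integral_def)
qed

section \<open>The covariance matrix of the process\<close>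

lemma has_wiener_integral_cong_AE:
  assumes I: "has_wiener_integral M B a b F I" and "J \<in> borel_measurable M"
    and eq: "AE \<omega> in M. J \<omega> = I \<omega>"
  shows "has_wiener_integral M B a b F J"
proof -
  have "(\<integral>\<^sup>+ \<omega>. ennreal ((norm (J \<omega> - X \<omega>))\<^sup>2) \<partial>M) = (\<integral>\<^sup>+ \<omega>. ennreal ((norm (I \<omega> - X \<omega>))\<^sup>2) \<partial>M)" for X
    by (rule nn_integral_cong_AE) (use eq in eventually_elim, simp)
  then show ?thesis
    using I \<open>J \<in> borel_measurable M\<close> unfolding has_wiener_integral_def by simp
qed

lemma antidiagonal_square:
  fixes a b :: real
  defines "A \<equiv> vector [vector [0, a], vector [b, 0]] :: real^2^2"
  shows "A ** A = (a * b) *\<^sub>R mat 1"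
  by (simp add: A_def vec_eq_iff forall_2 matrix_matrix_mult_def sum_2 mat_def)

text \<open>
  With \<open>S\<close> symmetric with entries \<open>p\<close>, \<open>q\<close>, \<open>r\<close>, the Lyapunov equation reads \<open>p = 1 + 2 * a * q\<close>,
  \<open>r = 1 + 2 * b * q\<close> and \<open>q = a * r + b * p\<close>; eliminating \<open>p\<close> and \<open>r\<close> gives
  \<open>(1 - 4 * a * b) * q = a + b\<close>.
\<close>

lemma antidiagonal_lyapunov:
  fixes a b :: real
  assumes "4 * a * b \<noteq> 1"
  defines "A \<equiv> vector [vector [0, a], vector [b, 0]] :: real^2^2"
    and "S \<equiv> (1 / (1 - 4 * a * b)) *\<^sub>R vector [vector [1 + 2 * a\<^sup>2 - 2 * a * b, a + b],
                 vector [a + b, 1 + 2 * b\<^sup>2 - 2 * a * b]] :: real^2^2"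
  shows "S = mat 1 + A ** S + S ** transpose A"
proof -
  define d where "d = 1 / (1 - 4 * a * b)"
  have d: "d * (1 - 4 * a * b) = 1" using assms(1) by (simp add: d_def)
  define p q r where "p = d * (1 + 2 * a\<^sup>2 - 2 * a * b)" and "q = d * (a + b)"
    and "r = d * (1 + 2 * b\<^sup>2 - 2 * a * b)"
  have eqs: "p = 1 + a * q + q * a" "r = 1 + b * q + q * b"
    using d unfolding p_def q_def r_def by algebra+
  have eqs': "q = a * r + p * b" "q = b * p + r * a"
    unfolding p_def q_def r_def by (simp_all add: algebra_simps power2_eq_square)
  have S: "S = vector [vector [p, q], vector [q, r]]"
    by (simp add: S_def d_def[symmetric] p_def q_def r_def vec_eq_iff forall_2)
  have "mat 1 + A ** S + S ** transpose A
      = vector [vector [1 + a * q + q * a, a * r + p * b], vector [b * p + r * a, 1 + b * q + q * b]]"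
    unfolding S A_def
    by (simp add: vec_eq_iff forall_2 matrix_matrix_mult_def sum_2 mat_def transpose_def)
  also have "\<dots> = S"
    unfolding S eqs(1,2)[symmetric] eqs'[symmetric] ..
  finally show ?thesis ..
qed

theorem proposition3p3:
  fixes \<alpha>\<^sub>1 \<alpha>\<^sub>2 :: real
    and A \<Sigma> :: "real^2^2"
    and M :: "'a measure"
    and B Z :: "real \<Rightarrow> 'a \<Rightarrow> real^2"
  assumes "\<alpha>\<^sub>1 \<in> {-1..1}" and "\<alpha>\<^sub>2 \<in> {-1..1}"
    and "A = vector [vector [0, \<alpha>\<^sub>1], vector [\<alpha>\<^sub>2, 0]]"
    and "standard_brownian_motion M B"
    and "\<alpha>\<^sub>1 * \<alpha>\<^sub>2 < 1/4"
    and "\<And>t. 0 < t \<Longrightarrow> Z t \<in> borel_measurable M"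
    and "\<And>t. 0 < t \<Longrightarrow>
           AE \<omega> in M. Z t \<omega> = wiener_integral M B 0 t (\<lambda>s. rpow_matrix (t / s) A) \<omega>"
    and "\<Sigma> = (LINT \<omega>|M. outer_prod (Z 1 \<omega>) (Z 1 \<omega>))"
  shows "(\<forall>t>0. square_integrable_on (\<lambda>s. rpow_matrix (t / s) A) {0<..<t})
    \<and> (\<forall>s t. 0 < s \<and> s \<le> t \<longrightarrow>
         integrable M (\<lambda>\<omega>. outer_prod (Z s \<omega>) (Z t \<omega>)) \<and>
         (LINT \<omega>|M. outer_prod (Z s \<omega>) (Z t \<omega>)) =
           s *\<^sub>R (\<Sigma> ** rpow_matrix (t / s) (transpose A)))
    \<and> \<Sigma> = (1 / (1 - 4 * \<alpha>\<^sub>1 * \<alpha>\<^sub>2)) *\<^sub>R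
         vector [vector [1 + 2 * \<alpha>\<^sub>1\<^sup>2 - 2 * \<alpha>\<^sub>1 * \<alpha>\<^sub>2, \<alpha>\<^sub>1 + \<alpha>\<^sub>2],
                 vector [\<alpha>\<^sub>1 + \<alpha>\<^sub>2, 1 + 2 * \<alpha>\<^sub>2\<^sup>2 - 2 * \<alpha>\<^sub>1 * \<alpha>\<^sub>2]]"
proof -
  interpret standard_brownian_motion M B by fact
  define c where "c = \<alpha>\<^sub>1 * \<alpha>\<^sub>2"
  define S :: "real^2^2" where "S = (1 / (1 - 4 * \<alpha>\<^sub>1 * \<alpha>\<^sub>2)) *\<^sub>R
         vector [vector [1 + 2 * \<alpha>\<^sub>1\<^sup>2 - 2 * \<alpha>\<^sub>1 * \<alpha>\<^sub>2, \<alpha>\<^sub>1 + \<alpha>\<^sub>2],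
                 vector [\<alpha>\<^sub>1 + \<alpha>\<^sub>2, 1 + 2 * \<alpha>\<^sub>2\<^sup>2 - 2 * \<alpha>\<^sub>1 * \<alpha>\<^sub>2]]"
  have c: "c < 1/4" using assms(5) by (simp add: c_def)
  have A: "A ** A = c *\<^sub>R mat 1"
    unfolding assms(3) c_def by (rule antidiagonal_square)
  have S: "S = mat 1 + A ** S + S ** transpose A"
    unfolding assms(3) S_def by (rule antidiagonal_lyapunov) (use assms(5) in simp)
  have sq: "square_integrable_on (\<lambda>s. rpow_matrix (t / s) A) {0<..<t}" if "0 < t" for t
    by (rule square_integrable_rpow_matrix[OF A c S that])
  have Z: "has_wiener_integral M B 0 t (\<lambda>s. rpow_matrix (t / s) A) (Z t)" if t: "0 < t" for t
  proof -
    have "continuous_on {0<..<t} (\<lambda>s. rpow_matrix (t / s) A)"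
      by (rule continuous_on_subset[OF continuous_on_rpow_matrix[OF A t]]) auto
    then have "\<exists>I. has_wiener_integral M B 0 t (\<lambda>s. rpow_matrix (t / s) A) I"
      using has_wiener_integral_exists[OF order_refl t _ sq[OF t]] by blast
    then have "has_wiener_integral M B 0 t (\<lambda>s. rpow_matrix (t / s) A)
        (wiener_integral M B 0 t (\<lambda>s. rpow_matrix (t / s) A))"
      unfolding wiener_integral_def by (rule someI_ex)
    then show ?thesis
      by (rule has_wiener_integral_cong_AE) (use assms(6,7) t in auto)
  qed
  have cov: "integrable M (\<lambda>\<omega>. outer_prod (Z s \<omega>) (Z t \<omega>))"
    "(LINT \<omega>|M. outer_prod (Z s \<omega>) (Z t \<omega>)) = s *\<^sub>R (S ** rpow_matrix (t / s) (transpose A))"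
    if "0 < s" "s \<le> t" for s t
  proof -
    have t: "0 < t" using that by simp
    have eq: "{0<..<s} \<inter> {0<..<t} = {0<..<s}" using that by auto
    note Zst = wiener_integral_covariance[OF Z[OF \<open>0 < s\<close>] Z[OF t] order_refl order_refl, unfolded eq]
    show "integrable M (\<lambda>\<omega>. outer_prod (Z s \<omega>) (Z t \<omega>))" by (rule Zst(1))
    show "(LINT \<omega>|M. outer_prod (Z s \<omega>) (Z t \<omega>)) = s *\<^sub>R (S ** rpow_matrix (t / s) (transpose A))"
      unfolding Zst(3) by (rule integral_rpow_matrix_product[OF A c S \<open>0 < s\<close> t Zst(2)])
  qed
  have "\<Sigma> = S"
    using cov(2)[of 1 1] assms(8) by (simp add: rpow_matrix_transpose[OF A] rpow_matrix_1[OF A])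
  then show ?thesis
    using sq cov unfolding S_def[symmetric] by blast
qed

end
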